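(* Let $m>1$ be an integer, let $\ell$ be an odd integer, and let $K$ be the finite $2$-group with generators $a,b$ defined in the context. For every $x,y\in Z_1(K)$ the assignment $a\mapsto ax$, $b\mapsto by$ extends to a central automorphism $\Omega_{(x,y)}$ of $K$ that fixes $Z_2(K)$ pointwise. Moreover, the corresponding map $\Omega:Z_1(K)\times Z_1(K)\to\mathrm{Aut}(K)$, $(x,y)\mapsto\Omega_{(x,y)}$, is a group monomorphism whose image is $\mathrm{Aut}_1(K)$. In particular, $|\mathrm{Aut}_1(K)|=2^{4(m-1)}$.
   Context: Notation: $[a,b]=a^{-1}b^{-1}ab$, $b^a=a^{-1}ba$, $\alpha=1+2^m\ell$. Let $$J=\langle A,B\mid A^{[A,B]}=A^{\alpha},\ B^{[B,A]}=B^{\alpha},\ A^{2^{3m-1}}=B^{2^{3m-1}}=1\rangle$$ and $K=J/Z_2(J)$, which has the presentation $$K=\langle a,b\mid a^{[a,b]}=a^{\alpha},\ b^{[b,a]}=b^{\alpha},\ a^{2^{2m-1}}=b^{2^{2m-1}}=[a,b]^{2^{m-1}}=1\rangle.$$ For a group $T$, $Z_0(T)=1, Z_1(T),Z_2(T),\dots$ denotes the upper central series, and $\mathrm{Aut}_i(T)$ is the kernel of the canonical map $\mathrm{Aut}(T)\to\mathrm{Aut}(T/Z_i(T))$. An automorphism of $T$ is central if it belongs to $\mathrm{Aut}_1(T)$. *)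

theory Defs
  imports "HOL-Algebra.Coset" "HOL-Algebra.Bij"
begin

section \<open>Groups given by generators and relations\<close>

text \<open>A word over \<^typ>\<open>'x\<close> is a list of letters; the letter \<open>(x, True)\<close> stands for the
  generator \<open>x\<close> and \<open>(x, False)\<close> for its formal inverse.\<close>

type_synonym 'x word = "('x \<times> bool) list"

definition wgen :: "'x \<Rightarrow> 'x word" where
  "wgen x = [(x, True)]"

definition winv :: "'x word \<Rightarrow> 'x word" where
  "winv w = rev (map (\<lambda>(x, s). (x, \<not> s)) w)"

definition wpow :: "'x word \<Rightarrow> int \<Rightarrow> 'x word" where
  "wpow w k = (if 0 \<le> k then concat (replicate (nat k) w)
               else concat (replicate (nat (- k)) (winv w)))"

text \<open>The conventions are \<open>[u, v] = u\<inverse> v\<inverse> u v\<close> and \<open>u\<close> conjugated by \<open>v\<close> is \<open>v\<inverse> u v\<close>.\<close>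

definition wcomm :: "'x word \<Rightarrow> 'x word \<Rightarrow> 'x word" where
  "wcomm u v = winv u @ winv v @ u @ v"

definition wconj :: "'x word \<Rightarrow> 'x word \<Rightarrow> 'x word" where
  "wconj u v = winv v @ u @ v"

text \<open>A relation \<open>u = v\<close> is the pair \<open>(u, v)\<close>. Two words represent the same element of the
  presented group iff they are related by the least congruence on words that contains the
  relations and the free cancellations.\<close>

inductive word_eq :: "('x word \<times> 'x word) set \<Rightarrow> 'x word \<Rightarrow> 'x word \<Rightarrow> bool"
  for R :: "('x word \<times> 'x word) set" where
  rel: "(u, v) \<in> R \<Longrightarrow> word_eq R u v"
| cancel: "word_eq R [(x, s), (x, \<not> s)] []"
| refl: "word_eq R u u"
| sym: "word_eq R u v \<Longrightarrow> word_eq R v u"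
| trans: "word_eq R u v \<Longrightarrow> word_eq R v w \<Longrightarrow> word_eq R u w"
| app: "word_eq R u v \<Longrightarrow> word_eq R u' v' \<Longrightarrow> word_eq R (u @ u') (v @ v')"

definition word_class :: "('x word \<times> 'x word) set \<Rightarrow> 'x word \<Rightarrow> 'x word set" where
  "word_class R w = {v. word_eq R w v}"

definition presented_group :: "('x word \<times> 'x word) set \<Rightarrow> 'x word set monoid" where
  "presented_group R =
     \<lparr>carrier = range (word_class R),
      mult = (\<lambda>U V. {w. \<exists>u\<in>U. \<exists>v\<in>V. word_eq R (u @ v) w}),
      one = word_class R []\<rparr>"

lemma word_class_eq_iff: "word_class R u = word_class R v \<longleftrightarrow> word_eq R u v"
  unfolding word_class_def by (blast intro: word_eq.refl word_eq.sym word_eq.trans)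

lemma presented_group_mult:
  "word_class R u \<otimes>\<^bsub>presented_group R\<^esub> word_class R v = word_class R (u @ v)"
  unfolding word_class_def presented_group_def
  by simp (blast intro: word_eq.refl word_eq.sym word_eq.trans word_eq.app)

lemma word_eq_winv: "word_eq R (winv w @ w) []"
proof (induction w)
  case Nil
  show ?case by (simp add: winv_def word_eq.refl)
next
  case (Cons a w)
  obtain x s where a: "a = (x, s)" by (cases a)
  have "word_eq R [(x, \<not> s), (x, s)] []"
    using word_eq.cancel[of R x "\<not> s"] by simp
  then have "word_eq R (winv w @ [(x, \<not> s), (x, s)] @ w) (winv w @ [] @ w)"
    by (intro word_eq.app word_eq.refl)
  then show ?case
    using Cons.IH by (auto simp: a winv_def intro: word_eq.trans)
qed

lemma group_presented_group: "group (presented_group R)"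
proof (rule groupI)
  show "\<one>\<^bsub>presented_group R\<^esub> \<in> carrier (presented_group R)"
    by (simp add: presented_group_def)
next
  fix U V assume "U \<in> carrier (presented_group R)" "V \<in> carrier (presented_group R)"
  then obtain u v where "U = word_class R u" "V = word_class R v"
    by (auto simp: presented_group_def)
  then show "U \<otimes>\<^bsub>presented_group R\<^esub> V \<in> carrier (presented_group R)"
    by (simp only: presented_group_mult) (simp add: presented_group_def)
next
  fix U V W
  assume "U \<in> carrier (presented_group R)" "V \<in> carrier (presented_group R)"
    "W \<in> carrier (presented_group R)"
  then obtain u v w where "U = word_class R u" "V = word_class R v" "W = word_class R w"
    by (auto simp: presented_group_def)
  then show "U \<otimes>\<^bsub>presented_group R\<^esub> V \<otimes>\<^bsub>presented_group R\<^esub> W =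
      U \<otimes>\<^bsub>presented_group R\<^esub> (V \<otimes>\<^bsub>presented_group R\<^esub> W)"
    by (simp add: presented_group_mult)
next
  fix U assume "U \<in> carrier (presented_group R)"
  then obtain u where U: "U = word_class R u"
    by (auto simp: presented_group_def)
  have one: "\<one>\<^bsub>presented_group R\<^esub> = word_class R []"
    by (simp add: presented_group_def)
  show "\<one>\<^bsub>presented_group R\<^esub> \<otimes>\<^bsub>presented_group R\<^esub> U = U"
    by (simp add: U one presented_group_mult)
  have "word_class R (winv u) \<otimes>\<^bsub>presented_group R\<^esub> U = \<one>\<^bsub>presented_group R\<^esub>"
    by (simp add: U one presented_group_mult word_class_eq_iff word_eq_winv)
  moreover have "word_class R (winv u) \<in> carrier (presented_group R)"
    by (simp add: presented_group_def)
  ultimately show "\<exists>V\<in>carrier (presented_group R).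
      V \<otimes>\<^bsub>presented_group R\<^esub> U = \<one>\<^bsub>presented_group R\<^esub>"
    by blast
qed

text \<open>The group \<open>G\<close> with the family \<open>g\<close> of elements has the presentation
  \<open>\<langle>x | R\<rangle>\<close>, the generator \<open>x\<close> being represented by \<open>g x\<close>.\<close>

definition has_presentation ::
    "('g, 'h) monoid_scheme \<Rightarrow> ('x \<Rightarrow> 'g) \<Rightarrow> ('x word \<times> 'x word) set \<Rightarrow> bool" where
  "has_presentation G g R \<longleftrightarrow> group G \<and>
     (\<exists>h \<in> iso (presented_group R) G. \<forall>x. h (word_class R (wgen x)) = g x)"

section \<open>The group \<open>K\<close>\<close>

datatype gen = GenA | GenB

definition K_rels :: "nat \<Rightarrow> int \<Rightarrow> (gen word \<times> gen word) set" where
  "K_rels m l =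
     (let a = wgen GenA; b = wgen GenB; \<alpha> = 1 + 2 ^ m * l in
       {(wconj a (wcomm a b), wpow a \<alpha>),
        (wconj b (wcomm b a), wpow b \<alpha>),
        (wpow a (2 ^ (2 * m - 1)), []),
        (wpow b (2 ^ (2 * m - 1)), []),
        (wpow (wcomm a b) (2 ^ (m - 1)), [])})"

definition K_presentation ::
    "('g, 'h) monoid_scheme \<Rightarrow> 'g \<Rightarrow> 'g \<Rightarrow> nat \<Rightarrow> int \<Rightarrow> bool" where
  "K_presentation K a b m l \<longleftrightarrow>
     has_presentation K (\<lambda>g. case g of GenA \<Rightarrow> a | GenB \<Rightarrow> b) (K_rels m l)"

section \<open>Upper central series and the automorphism groups attached to it\<close>

definition center :: "('g, 'h) monoid_scheme \<Rightarrow> 'g set" where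
  "center G = {z \<in> carrier G. \<forall>x \<in> carrier G. z \<otimes>\<^bsub>G\<^esub> x = x \<otimes>\<^bsub>G\<^esub> z}"

text \<open>\<open>Z\<^sub>i\<^sub>+\<^sub>1(G)\<close> is the preimage of the centre of \<open>G / Z\<^sub>i(G)\<close>.\<close>

primrec upper_central :: "('g, 'h) monoid_scheme \<Rightarrow> nat \<Rightarrow> 'g set" where
  "upper_central G 0 = {\<one>\<^bsub>G\<^esub>}"
| "upper_central G (Suc i) =
     {x \<in> carrier G. upper_central G i #>\<^bsub>G\<^esub> x \<in> center (G Mod upper_central G i)}"

text \<open>The canonical map \<open>Aut(G) \<rightarrow> Aut(G / Z\<^sub>i(G))\<close>: an automorphism acts on a coset by taking
  its image. The restriction matches the convention of \<^const>\<open>AutoGroup\<close>, whose elements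
  are extensional functions.\<close>

definition aut_quot ::
    "('g, 'h) monoid_scheme \<Rightarrow> nat \<Rightarrow> ('g \<Rightarrow> 'g) \<Rightarrow> 'g set \<Rightarrow> 'g set" where
  "aut_quot G i \<phi> = (\<lambda>C \<in> carrier (G Mod upper_central G i). \<phi> ` C)"

definition Aut_i :: "nat \<Rightarrow> ('g, 'h) monoid_scheme \<Rightarrow> ('g \<Rightarrow> 'g) set" where
  "Aut_i i G = kernel (AutoGroup G) (AutoGroup (G Mod upper_central G i)) (aut_quot G i)"

text \<open>The automorphism of \<open>G\<close> with \<open>a \<mapsto> a x\<close>, \<open>b \<mapsto> b y\<close>; it is unspecified unless
  exactly one such automorphism exists.\<close>

definition Omega :: "('g, 'h) monoid_scheme \<Rightarrow> 'g \<Rightarrow> 'g \<Rightarrow> 'g \<times> 'g \<Rightarrow> 'g \<Rightarrow> 'g" where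
  "Omega G a b = (\<lambda>(x, y). THE \<phi>. \<phi> \<in> carrier (AutoGroup G) \<and>
     \<phi> a = a \<otimes>\<^bsub>G\<^esub> x \<and> \<phi> b = b \<otimes>\<^bsub>G\<^esub> y)"

end

theory Submission
  imports Defs
begin

text \<open>Put \<open>Q = 2\<^sup>m\<^sup>-\<^sup>1\<close>, \<open>r = \<ell>\<close> and \<open>c = [a, b]\<close>, so that \<open>\<alpha> = 1 + 2Qr\<close>, \<open>a\<close> and \<open>b\<close> have order
dividing \<open>2Q\<^sup>2\<close>, and \<open>c\<close> has order dividing \<open>Q\<close>. The relations say \<open>[a, c] = a\<^sup>2\<^sup>Q\<^sup>r\<close> and \<open>[c, b] =
b\<^sup>2\<^sup>Q\<^sup>r\<close>. Computing \<open>b\<inverse> a\<^sup>2\<^sup>Q b = (ac)\<^sup>2\<^sup>Q\<close> inside the group \<open>\<langle>a, c\<rangle>\<close>, where \<open>[a, c]\<close>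
is central, gives \<open>a\<^sup>2\<^sup>Q\<close> back, so \<open>a\<^sup>2\<^sup>Q\<close>, and by symmetry \<open>b\<^sup>2\<^sup>Q\<close>, is central. Hence \<open>K\<close> has class
at most three and collection brings every element to the form \<open>a\<^sup>i b\<^sup>j c\<^sup>k\<close>, with an explicit
product formula (\<open>collect_hom\<close>, \<open>nf_mult\<close>).

The form is unique for \<open>i\<close>, \<open>j\<close> modulo \<open>2Q\<^sup>2\<close> and \<open>k\<close> modulo \<open>Q\<close>. To see this, realise the free
nilpotent group of class three on two generators on \<open>\<int>\<^sup>5\<close>, with exponents of \<open>a\<close>, \<open>b\<close>, \<open>c\<close>, \<open>[a,
c]\<close>, \<open>[c, b]\<close>, and divide by the normal subgroup that the relations of \<open>K\<close> force
(\<open>nil3_lattice_normal\<close>). The quotient satisfies the relations of \<open>K\<close>, so \<open>K\<close> maps onto it, and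
there the exponents can be read off.

Comparing normal forms of \<open>xa\<close>, \<open>ax\<close> and of \<open>xb\<close>, \<open>bx\<close> now shows that the centre consists of the
elements \<open>a\<^sup>2\<^sup>Q\<^sup>s b\<^sup>2\<^sup>Q\<^sup>t\<close>: it has order \<open>Q\<^sup>2\<close> and exponent dividing \<open>Q\<close>. Likewise \<open>Q\<close> divides \<open>i\<close> and
\<open>j\<close> for every element \<open>a\<^sup>i b\<^sup>j c\<^sup>k\<close> of the second centre.

For central \<open>x\<close>, \<open>y\<close> the elements \<open>ax\<close>, \<open>by\<close> have commutator \<open>c\<close>, and since \<open>x\<^sup>Q = y\<^sup>Q = 1\<close> they
satisfy the relations of \<open>K\<close> again. The resulting endomorphism sends \<open>a\<^sup>i b\<^sup>j c\<^sup>k\<close> to \<open>x\<^sup>i y\<^sup>j a\<^sup>i b\<^sup>j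
c\<^sup>k\<close> (\<open>twist_nf\<close>). It is therefore trivial modulo the centre, and it fixes the second centre
pointwise, where \<open>Q\<close> divides \<open>i\<close> and \<open>j\<close>. In particular these endomorphisms fix the centre,
hence compose by multiplying the parameters, so they are invertible and form a copy of
\<open>Z\<^sub>1(K) \<times> Z\<^sub>1(K)\<close>. Every central automorphism is of this kind, because it
multiplies \<open>a\<close> and \<open>b\<close> by central elements.\<close>

section \<open>Evaluation of words and the universal property of a presentation\<close>

primrec weval :: "('g, 'h) monoid_scheme \<Rightarrow> ('x \<Rightarrow> 'g) \<Rightarrow> 'x word \<Rightarrow> 'g" where
  "weval G f [] = \<one>\<^bsub>G\<^esub>"
| "weval G f (p # w) = (if snd p then f (fst p) else inv\<^bsub>G\<^esub> f (fst p)) \<otimes>\<^bsub>G\<^esub> weval G f w"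

lemma winv_Cons: "winv (p # w) = winv w @ [(fst p, \<not> snd p)]"
  by (cases p) (simp add: winv_def)

context group
begin

lemma weval_closed [simp, intro]:
  assumes "range f \<subseteq> carrier G"
  shows "weval G f w \<in> carrier G"
  using assms by (induction w) (auto simp: image_subset_iff)

lemma weval_append:
  assumes "range f \<subseteq> carrier G"
  shows "weval G f (u @ v) = weval G f u \<otimes> weval G f v"
proof (induction u)
  case (Cons p u)
  have "f (fst p) \<in> carrier G"
    using assms by auto
  then show ?case
    using Cons assms by (simp add: m_assoc)
qed (use assms in auto)

lemma weval_winv:
  assumes "range f \<subseteq> carrier G"
  shows "weval G f (winv w) = inv (weval G f w)"
proof (induction w)
  case Nil
  then show ?case by (simp add: winv_def)
next
  case (Cons p w)
  have "f (fst p) \<in> carrier G"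
    using assms by auto
  then show ?case
    using Cons assms by (simp add: winv_Cons weval_append inv_mult_group)
qed

lemma weval_wgen:
  assumes "range f \<subseteq> carrier G"
  shows "weval G f (wgen x) = f x"
proof -
  have "f x \<in> carrier G"
    using assms by auto
  then show ?thesis
    by (simp add: wgen_def)
qed

lemma weval_wpow:
  assumes "range f \<subseteq> carrier G"
  shows "weval G f (wpow w k) = weval G f w [^] k"
proof -
  have *: "weval G f (concat (replicate n v)) = weval G f v [^] n" for n v
    by (induction n) (simp_all add: assms weval_append nat_pow_Suc2[symmetric] del: nat_pow_Suc)
  show ?thesis
  proof (cases "0 \<le> k")
    case True
    then show ?thesis
      by (simp add: wpow_def *)
  next
    case False
    then show ?thesis
      using assms by (simp add: wpow_def * weval_winv int_pow_inv int_pow_neg)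
  qed
qed

lemma weval_wcomm:
  assumes "range f \<subseteq> carrier G"
  shows "weval G f (wcomm u v) =
    inv (weval G f u) \<otimes> inv (weval G f v) \<otimes> weval G f u \<otimes> weval G f v"
  using assms by (simp add: wcomm_def weval_append weval_winv m_assoc)

lemma weval_wconj:
  assumes "range f \<subseteq> carrier G"
  shows "weval G f (wconj u v) = inv (weval G f v) \<otimes> weval G f u \<otimes> weval G f v"
  using assms by (simp add: wconj_def weval_append weval_winv m_assoc)

lemma weval_word_eq:
  assumes "range f \<subseteq> carrier G" "\<And>u v. (u, v) \<in> R \<Longrightarrow> weval G f u = weval G f v"
    and "word_eq R u v"
  shows "weval G f u = weval G f v"
  using assms(3)
proof induction
  case (cancel x s)
  have "f x \<in> carrier G"
    using assms(1) by auto
  then show ?case by simp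
qed (simp_all add: assms weval_append)

text \<open>Relations that hold in \<open>G\<close> are respected by the whole congruence, so evaluating any
representative of a class gives the same element.\<close>

theorem von_Dyck:
  assumes "range f \<subseteq> carrier G" "\<And>u v. (u, v) \<in> R \<Longrightarrow> weval G f u = weval G f v"
  obtains h where "h \<in> hom (presented_group R) G" "\<And>w. h (word_class R w) = weval G f w"
proof
  define h where "h = (\<lambda>U. weval G f (SOME w. w \<in> U))"
  show h: "h (word_class R w) = weval G f w" for w
  proof -
    have "word_eq R w (SOME v. v \<in> word_class R w)"
      by (rule someI2[of _ w]) (auto simp: word_class_def intro: word_eq.refl)
    then show ?thesis
      using weval_word_eq[OF assms] by (simp add: h_def)
  qed
  show "h \<in> hom (presented_group R) G"
  proof (rule homI)
    fix U assume "U \<in> carrier (presented_group R)"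
    then show "h U \<in> carrier G"
      using assms(1) by (auto simp: presented_group_def h)
  next
    fix U V assume "U \<in> carrier (presented_group R)" "V \<in> carrier (presented_group R)"
    then obtain u v where "U = word_class R u" "V = word_class R v"
      by (auto simp: presented_group_def)
    then show "h (U \<otimes>\<^bsub>presented_group R\<^esub> V) = h U \<otimes> h V"
      using assms(1) by (simp add: presented_group_mult h weval_append)
  qed
qed

end

lemma weval_hom:
  assumes "group G" "group H" "\<phi> \<in> hom G H" "range f \<subseteq> carrier G"
  shows "\<phi> (weval G f w) = weval H (\<phi> \<circ> f) w"
proof -
  interpret group_hom G H \<phi>
    using assms by (simp add: group_hom_def group_hom_axioms_def)
  show ?thesis
  proof (induction w)
    case (Cons p w)
    have "f (fst p) \<in> carrier G"
      using assms by auto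
    then show ?case
      using Cons assms(4) by simp
  qed simp
qed

lemma weval_presented_group:
  "weval (presented_group R) (\<lambda>x. word_class R (wgen x)) w = word_class R w"
proof (induction w)
  case Nil
  then show ?case by (simp add: presented_group_def)
next
  case (Cons p w)
  interpret group "presented_group R"
    by (rule group_presented_group)
  have carr: "word_class R w \<in> carrier (presented_group R)" for w
    by (simp add: presented_group_def)
  have one: "\<one>\<^bsub>presented_group R\<^esub> = word_class R []"
    by (simp add: presented_group_def)
  have "inv\<^bsub>presented_group R\<^esub> (word_class R (wgen x)) = word_class R [(x, False)]" for x
  proof (rule inv_equality)
    have "word_eq R [(x, False), (x, True)] []"
      using word_eq.cancel[of R x False] by simp
    then show "word_class R [(x, False)] \<otimes>\<^bsub>presented_group R\<^esub> word_class R (wgen x) =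
        \<one>\<^bsub>presented_group R\<^esub>"
      by (simp add: presented_group_mult wgen_def word_class_eq_iff one)
  qed (rule carr)+
  then show ?case
    using Cons by (cases p) (simp add: presented_group_mult wgen_def)
qed

text \<open>The presentation is given only by an isomorphism with a quotient of the monoid of words.
These four consequences are all that is ever used of it: the generators lie in \<open>G\<close>, satisfy the
relations, generate \<open>G\<close>, and may be sent to any elements of any group that satisfy the
relations.\<close>

lemma
  assumes "has_presentation G g R"
  shows has_presentation_range: "range g \<subseteq> carrier G"
    and has_presentation_rel: "\<And>u v. (u, v) \<in> R \<Longrightarrow> weval G g u = weval G g v"
    and has_presentation_generated: "\<And>x. x \<in> carrier G \<Longrightarrow> \<exists>w. x = weval G g w"
    and has_presentation_extend: "\<And>H :: ('b, 'c) monoid_scheme. \<And>f.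
      \<lbrakk>group H; range f \<subseteq> carrier H; \<And>u v. (u, v) \<in> R \<Longrightarrow> weval H f u = weval H f v\<rbrakk>
      \<Longrightarrow> \<exists>\<phi> \<in> hom G H. \<forall>x. \<phi> (g x) = f x"
proof -
  interpret group G
    using assms by (simp add: has_presentation_def)
  interpret P: group "presented_group R"
    by (rule group_presented_group)
  obtain h where h: "h \<in> iso (presented_group R) G" "\<And>x. h (word_class R (wgen x)) = g x"
    using assms by (auto simp: has_presentation_def)
  have hom: "h \<in> hom (presented_group R) G"
    using h(1) by (simp add: iso_def)
  have carr: "word_class R w \<in> carrier (presented_group R)" for w
    by (simp add: presented_group_def)
  show range: "range g \<subseteq> carrier G"
    using hom_in_carrier[OF hom carr] h(2) by (metis image_subsetI)
  have hw: "h (word_class R w) = weval G g w" for w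
    using weval_hom[OF P.is_group is_group hom, of "\<lambda>x. word_class R (wgen x)" w] carr h(2)
    by (auto simp: weval_presented_group o_def)
  show "weval G g u = weval G g v" if "(u, v) \<in> R" for u v
    using word_eq.rel[OF that] by (metis hw word_class_eq_iff)
  show "\<exists>w. x = weval G g w" if "x \<in> carrier G" for x
  proof -
    have "x \<in> h ` carrier (presented_group R)"
      using h(1) that by (auto simp: iso_def bij_betw_def)
    then show ?thesis
      by (auto simp: presented_group_def hw)
  qed
  show "\<exists>\<phi> \<in> hom G H. \<forall>x. \<phi> (g x) = f x"
    if "group H" and f: "range f \<subseteq> carrier H" "\<And>u v. (u, v) \<in> R \<Longrightarrow> weval H f u = weval H f v"
    for H :: "('b, 'c) monoid_scheme" and f
  proof -
    interpret H: group H by fact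
    obtain k where k: "k \<in> hom (presented_group R) H" "\<And>w. k (word_class R w) = weval H f w"
      using H.von_Dyck[OF f] by blast
    define h' where "h' = inv_into (carrier (presented_group R)) h"
    have "h' \<in> iso G (presented_group R)"
      unfolding h'_def using P.iso_set_sym[OF h(1)] .
    then have "k \<circ> h' \<in> hom G H"
      using k(1) Group.hom_compose[of h' G "presented_group R" k H] by (simp add: iso_def)
    moreover have "h' (g x) = word_class R (wgen x)" for x
      unfolding h'_def h(2)[symmetric] using h(1) carr
      by (intro inv_into_f_f) (auto simp: iso_def bij_betw_def)
    ultimately show ?thesis
      using k(2) H.weval_wgen[OF f(1)] by (intro bexI[of _ "k \<circ> h'"]) auto
  qed
qed

section \<open>The free nilpotent group of class three on two generators\<close>

text \<open>The binomial coefficient \<open>n\<close> over 2, for all integers: collection past inverse powers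
needs negative arguments.\<close>

definition tri :: "int \<Rightarrow> int" where
  "tri n = n * (n - 1) div 2"

lemma two_tri: "2 * tri n = n * (n - 1)"
  by (simp add: tri_def)

lemma tri_add: "tri (x + y) = tri x + tri y + x * y"
  using two_tri[of x] two_tri[of y] two_tri[of "x + y"] by (simp add: algebra_simps)

lemma tri_minus: "tri (- x) = tri x + x"
  using two_tri[of x] two_tri[of "- x"] by (simp add: algebra_simps)

lemma tri_0 [simp]: "tri 0 = 0"
  and tri_1 [simp]: "tri 1 = 0"
  by (simp_all add: tri_def)

lemma tri_double: "tri (2 * x) = x * (2 * x - 1)"
  using two_tri[of "2 * x"] by (simp add: algebra_simps)

text \<open>The tuple \<open>(i, j, k, p, q)\<close> stands for \<open>a\<^sup>i b\<^sup>j c\<^sup>k u\<^sup>p v\<^sup>q\<close> with \<open>c = [a, b]\<close>, \<open>u = [a, c]\<close>,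
\<open>v = [c, b]\<close>, and the product is the result of collecting in a group of nilpotency class three
(see \<open>collect_hom\<close> below). Working over the integers makes associativity a polynomial identity,
with no reduction of exponents.\<close>

definition nil3 :: "(int \<times> int \<times> int \<times> int \<times> int) monoid" where
  "nil3 = \<lparr>carrier = UNIV,
     mult = (\<lambda>(i, j, k, p, q) (i', j', k', p', q').
       (i + i', j + j', k + k' - i' * j,
        p + p' + j * tri i' - k * i',
        q + q' - i' * tri j - i' * j * j' + k * j')),
     one = (0, 0, 0, 0, 0)\<rparr>"

lemma carrier_nil3 [simp]: "carrier nil3 = UNIV"
  and one_nil3: "\<one>\<^bsub>nil3\<^esub> = (0, 0, 0, 0, 0)"
  and mult_nil3: "(i, j, k, p, q) \<otimes>\<^bsub>nil3\<^esub> (i', j', k', p', q') =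
       (i + i', j + j', k + k' - i' * j,
        p + p' + j * tri i' - k * i',
        q + q' - i' * tri j - i' * j * j' + k * j')"
  by (simp_all add: nil3_def)

lemma nil3_left_inverse:
  "(- i, - j, - k - i * j, - p - j * tri (- i) - k * i, - q - i * tri j + i * (j * j) + k * j)
     \<otimes>\<^bsub>nil3\<^esub> (i, j, k, p, q) = \<one>\<^bsub>nil3\<^esub>"
  using two_tri[of i] two_tri[of j]
  by (auto simp add: one_nil3 mult_nil3 tri_minus) algebra+

lemma group_nil3: "group nil3"
proof (rule groupI)
  fix x y z
  show "x \<otimes>\<^bsub>nil3\<^esub> y \<otimes>\<^bsub>nil3\<^esub> z = x \<otimes>\<^bsub>nil3\<^esub> (y \<otimes>\<^bsub>nil3\<^esub> z)"
    by (cases x, cases y, cases z) (simp add: mult_nil3 tri_add algebra_simps)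
next
  fix x
  show "\<one>\<^bsub>nil3\<^esub> \<otimes>\<^bsub>nil3\<^esub> x = x"
    by (cases x) (simp add: one_nil3 mult_nil3)
  show "\<exists>y\<in>carrier nil3. y \<otimes>\<^bsub>nil3\<^esub> x = \<one>\<^bsub>nil3\<^esub>"
    using nil3_left_inverse by (cases x) (metis UNIV_I carrier_nil3)
qed simp_all

lemma inv_nil3:
  "inv\<^bsub>nil3\<^esub> (i, j, k, p, q) =
     (- i, - j, - k - i * j, - p - j * tri (- i) - k * i, - q - i * tri j + i * (j * j) + k * j)"
  by (rule group.inv_equality[OF group_nil3 nil3_left_inverse]) simp_all

section \<open>Collection\<close>

text \<open>Most power identities below are proved by recognising a closed form: a sequence indexed by
the integers that starts at \<open>1\<close> and is multiplied by \<open>x\<close> at every step is the sequence of powers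
of \<open>x\<close>. This covers negative exponents without a separate induction.\<close>

lemma (in group) int_pow_unique:
  fixes n :: int
  assumes "x \<in> carrier G" "\<And>n. f n \<in> carrier G" "f 0 = \<one>" "\<And>n. f (n + 1) = f n \<otimes> x"
  shows "x [^] n = f n"
proof (induction n rule: int_induct[of _ 0])
  case (step1 i)
  then show ?case
    using assms by (simp add: int_pow_mult)
next
  case (step2 i)
  have "f i = f (i - 1) \<otimes> x"
    using assms(4)[of "i - 1"] by simp
  then show ?case
    using assms(1,2) step2(2)
    by (simp add: int_pow_diff) (metis inv_closed inv_solve_right int_pow_closed)
qed (use assms in simp)

context group
begin

text \<open>Turns a rule that moves \<open>x\<close> past \<open>y\<close> into one that also applies in the middle of a
right-associated product, so that the simplifier can carry out collection.\<close>

lemma commute_left: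
  assumes "x \<otimes> y = z" "x \<in> carrier G" "y \<in> carrier G" "w \<in> carrier G"
  shows "x \<otimes> (y \<otimes> w) = z \<otimes> w"
  using assms m_assoc by metis

lemma int_pow_comm:
  fixes i j :: int
  assumes "x \<otimes> y = y \<otimes> x" "x \<in> carrier G" "y \<in> carrier G"
  shows "x [^] i \<otimes> y [^] j = y [^] j \<otimes> x [^] i"
proof -
  have *: "x [^] i \<otimes> y = y \<otimes> x [^] i"
    if "x \<otimes> y = y \<otimes> x" "x \<in> carrier G" "y \<in> carrier G" for x y and i :: int
  proof -
    have "x [^] i = y \<otimes> x [^] i \<otimes> inv y"
    proof (rule int_pow_unique)
      fix n :: int
      have "inv y \<otimes> x = x \<otimes> inv y"
        using that by (metis inv_closed inv_solve_left inv_solve_right m_assoc m_closed)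
      then show "y \<otimes> x [^] (n + 1) \<otimes> inv y = y \<otimes> x [^] n \<otimes> inv y \<otimes> x"
        using that by (simp add: m_assoc int_pow_mult)
    qed (use that in simp_all)
    then show ?thesis
      using that by (metis inv_solve_right' int_pow_closed m_closed)
  qed
  show ?thesis
    using *[of x y i] *[of y "x [^] i" j] assms by simp
qed

lemma conj_int_pow:
  fixes n :: int
  assumes "x \<otimes> y = y \<otimes> x'" "x \<in> carrier G" "x' \<in> carrier G" "y \<in> carrier G"
  shows "x [^] n \<otimes> y = y \<otimes> x' [^] n"
proof -
  have "x' [^] n = inv y \<otimes> (x [^] n \<otimes> y)"
  proof (rule int_pow_unique)
    show "inv y \<otimes> (x [^] (n + 1) \<otimes> y) = inv y \<otimes> (x [^] n \<otimes> y) \<otimes> x'" for n :: int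
      using assms by (simp add: m_assoc int_pow_mult)
  qed (use assms in simp_all)
  then show ?thesis
    using assms by (simp add: m_assoc[symmetric])
qed

lemma commutator_int_pow:
  fixes i j :: int
  assumes "x \<otimes> y = y \<otimes> x \<otimes> z" "x \<otimes> z = z \<otimes> x" "y \<otimes> z = z \<otimes> y"
    and [simp]: "x \<in> carrier G" "y \<in> carrier G" "z \<in> carrier G"
  shows "x [^] i \<otimes> y [^] j = y [^] j \<otimes> x [^] i \<otimes> z [^] (i * j)"
proof -
  have *: "x [^] i \<otimes> y = y \<otimes> x [^] i \<otimes> z [^] i"
    if "x \<otimes> y = y \<otimes> x \<otimes> z" "x \<otimes> z = z \<otimes> x"
      "x \<in> carrier G" "y \<in> carrier G" "z \<in> carrier G" for x y z and i :: int
  proof -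
    have "(x \<otimes> z) [^] i = x [^] i \<otimes> z [^] i"
      by (rule int_pow_mult_distrib) (use that in simp_all)
    then show ?thesis
      using conj_int_pow[of x y "x \<otimes> z" i] that(1,3,4,5) by (simp add: m_assoc)
  qed
  have 1: "x [^] i \<otimes> y = y \<otimes> x [^] i \<otimes> z [^] i"
    using assms by (intro *)
  have 2: "y \<otimes> z [^] (- i) = z [^] (- i) \<otimes> y"
    using int_pow_comm[of y z 1 "- i"] assms by simp
  have "x [^] i \<otimes> y \<otimes> z [^] (- i) = y \<otimes> x [^] i"
    unfolding 1 by (simp add: m_assoc int_pow_mult[symmetric])
  then have "y \<otimes> x [^] i = x [^] i \<otimes> y \<otimes> z [^] (- i)"
    by simp
  then have 3: "y [^] j \<otimes> x [^] i = x [^] i \<otimes> y [^] j \<otimes> (z [^] (- i)) [^] j"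
    using 2 by (intro *) simp_all
  show ?thesis
    unfolding 3 by (simp add: m_assoc int_pow_pow int_pow_mult[symmetric])
qed

text \<open>The Hall formula in class two: in the step from \<open>n\<close> to \<open>n + 1\<close> the new factor \<open>x\<close> moves to
the left past \<open>y\<^sup>n\<close>, which costs \<open>z\<^sup>n\<close>, and these exponents add up to a triangular number.\<close>

lemma mult_int_pow_class2:
  fixes n :: int
  assumes "y \<otimes> x = x \<otimes> y \<otimes> z" "x \<otimes> z = z \<otimes> x" "y \<otimes> z = z \<otimes> y"
    and [simp]: "x \<in> carrier G" "y \<in> carrier G" "z \<in> carrier G"
  shows "(x \<otimes> y) [^] n = x [^] n \<otimes> y [^] n \<otimes> z [^] tri n"
proof (rule int_pow_unique)
  fix n :: int
  have yx: "y [^] n \<otimes> x = x \<otimes> y [^] n \<otimes> z [^] n"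
    using commutator_int_pow[of y x z n 1] assms by simp
  have zx: "z [^] i \<otimes> x = x \<otimes> z [^] i" and zy: "z [^] i \<otimes> y = y \<otimes> z [^] i" for i :: int
    using int_pow_comm[of z x i 1] int_pow_comm[of z y i 1] assms by simp_all
  have "x [^] n \<otimes> y [^] n \<otimes> z [^] tri n \<otimes> (x \<otimes> y)
      = x [^] n \<otimes> (y [^] n \<otimes> x) \<otimes> y \<otimes> z [^] tri n"
    by (simp add: m_assoc zy commute_left[OF zx])
  also have "\<dots> = x [^] n \<otimes> x \<otimes> y [^] n \<otimes> y \<otimes> (z [^] n \<otimes> z [^] tri n)"
    unfolding yx by (simp add: m_assoc commute_left[OF zy])
  also have "\<dots> = x [^] (n + 1) \<otimes> y [^] (n + 1) \<otimes> z [^] tri (n + 1)"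
    using int_pow_mult[of x n 1] int_pow_mult[of y n 1] int_pow_mult[of z n "tri n"]
    by (simp add: tri_add m_assoc add.commute[of "tri n"])
  finally show "x [^] (n + 1) \<otimes> y [^] (n + 1) \<otimes> z [^] tri (n + 1) =
      x [^] n \<otimes> y [^] n \<otimes> z [^] tri n \<otimes> (x \<otimes> y)" ..
qed simp_all

end

text \<open>The hypotheses \<open>ab\<close>, \<open>ac\<close>, \<open>cb\<close> say that \<open>c\<close>, \<open>u\<close>, \<open>v\<close> are the commutators \<open>[a, b]\<close>, \<open>[a,
c]\<close>, \<open>[c, b]\<close>. Since \<open>u\<close> and \<open>v\<close> commute with \<open>a\<close> and \<open>b\<close>, the subgroup generated by \<open>a\<close> and \<open>b\<close>
has class at most three.\<close>

locale class3_pair = group G for G (structure) +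
  fixes a b c u v :: 'a
  assumes carr [simp]: "a \<in> carrier G" "b \<in> carrier G" "c \<in> carrier G"
      "u \<in> carrier G" "v \<in> carrier G"
    and ab: "a \<otimes> b = b \<otimes> a \<otimes> c"
    and ac: "a \<otimes> c = c \<otimes> a \<otimes> u"
    and cb: "c \<otimes> b = b \<otimes> c \<otimes> v"
    and u_comm: "a \<otimes> u = u \<otimes> a" "b \<otimes> u = u \<otimes> b"
    and v_comm: "a \<otimes> v = v \<otimes> a" "b \<otimes> v = v \<otimes> b"
begin

lemma c_eq: "c = inv a \<otimes> (inv b \<otimes> (a \<otimes> b))"
  by (simp add: inv_solve_left inv_solve_left' ab m_assoc)

lemma commutes_c:
  assumes "a \<otimes> x = x \<otimes> a" "b \<otimes> x = x \<otimes> b" and [simp]: "x \<in> carrier G"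
  shows "c \<otimes> x = x \<otimes> c"
proof -
  have 1: "inv a \<otimes> x = x \<otimes> inv a" "inv b \<otimes> x = x \<otimes> inv b"
    using int_pow_comm[of a x "- 1" 1] int_pow_comm[of b x "- 1" 1] assms
    by (simp_all add: int_pow_neg)
  show ?thesis
    unfolding c_eq using assms 1 by (simp add: m_assoc commute_left[OF 1(1)]
        commute_left[OF 1(2)] commute_left[OF assms(1)])
qed

lemma pow_swap:
  fixes i j k p q :: int
  shows u_swap: "u [^] p \<otimes> a [^] i = a [^] i \<otimes> u [^] p"
      "u [^] p \<otimes> b [^] j = b [^] j \<otimes> u [^] p"
      "u [^] p \<otimes> c [^] k = c [^] k \<otimes> u [^] p"
    and v_swap: "v [^] q \<otimes> a [^] i = a [^] i \<otimes> v [^] q"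
      "v [^] q \<otimes> b [^] j = b [^] j \<otimes> v [^] q"
      "v [^] q \<otimes> c [^] k = c [^] k \<otimes> v [^] q"
      "v [^] q \<otimes> u [^] p = u [^] p \<otimes> v [^] q"
    and ca_swap: "c [^] k \<otimes> a [^] i = a [^] i \<otimes> (c [^] k \<otimes> u [^] (- k * i))"
    and cb_swap: "c [^] k \<otimes> b [^] j = b [^] j \<otimes> (c [^] k \<otimes> v [^] (k * j))"
proof -
  have cu: "c \<otimes> u = u \<otimes> c" and cv: "c \<otimes> v = v \<otimes> c"
    by (simp_all add: commutes_c u_comm v_comm)
  show "u [^] p \<otimes> a [^] i = a [^] i \<otimes> u [^] p" "u [^] p \<otimes> b [^] j = b [^] j \<otimes> u [^] p"
    "u [^] p \<otimes> c [^] k = c [^] k \<otimes> u [^] p"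
    "v [^] q \<otimes> a [^] i = a [^] i \<otimes> v [^] q" "v [^] q \<otimes> b [^] j = b [^] j \<otimes> v [^] q"
    "v [^] q \<otimes> c [^] k = c [^] k \<otimes> v [^] q"
    by (simp_all add: int_pow_comm u_comm v_comm cu cv)
  have "u \<otimes> v = v \<otimes> u"
  proof -
    have "b \<otimes> c \<otimes> (u \<otimes> v) = u \<otimes> (b \<otimes> c \<otimes> v)"
      by (simp add: m_assoc commute_left[OF u_comm(2)] commute_left[OF cu])
    also have "\<dots> = u \<otimes> (c \<otimes> b)"
      by (simp add: cb)
    also have "\<dots> = c \<otimes> b \<otimes> u"
      by (simp add: m_assoc u_comm(2) cu commute_left[OF cu])
    also have "\<dots> = b \<otimes> c \<otimes> (v \<otimes> u)"
      by (simp add: cb m_assoc)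
    finally show ?thesis
      by simp
  qed
  then show "v [^] q \<otimes> u [^] p = u [^] p \<otimes> v [^] q"
    by (simp add: int_pow_comm)
  have "a [^] i \<otimes> c [^] k = c [^] k \<otimes> a [^] i \<otimes> u [^] (i * k)"
    by (rule commutator_int_pow) (simp_all add: ac u_comm cu)
  then show "c [^] k \<otimes> a [^] i = a [^] i \<otimes> (c [^] k \<otimes> u [^] (- k * i))"
    by (simp add: m_assoc[symmetric]) (simp add: m_assoc int_pow_mult[symmetric] mult.commute)
  have "c [^] k \<otimes> b [^] j = b [^] j \<otimes> c [^] k \<otimes> v [^] (k * j)"
    by (rule commutator_int_pow) (simp_all add: cb v_comm cv)
  then show "c [^] k \<otimes> b [^] j = b [^] j \<otimes> (c [^] k \<otimes> v [^] (k * j))"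
    by (simp add: m_assoc)
qed

text \<open>The step of the collection in which all of the commutators arise. First \<open>a\<inverse> b a = b c\<inverse>\<close>
gives \<open>b\<^sup>j a\<close> through the power \<open>(b c\<inverse>)\<^sup>j\<close>; written as \<open>b\<^sup>j a = a' b\<^sup>j\<close>, this then gives \<open>b\<^sup>j a\<^sup>i =
a'\<^sup>i b\<^sup>j\<close>. Both powers are taken in subgroups of class at most two.\<close>

lemma ba_swap:
  fixes i j :: int
  shows "b [^] j \<otimes> a [^] i =
    a [^] i \<otimes> (b [^] j \<otimes> (c [^] (- i * j) \<otimes> (u [^] (j * tri i) \<otimes> v [^] (- i * tri j))))"
proof -
  have "b \<otimes> a = a \<otimes> b \<otimes> inv c"
    using ab by (simp add: inv_solve_right)
  then have "b [^] j \<otimes> a = a \<otimes> (b \<otimes> inv c) [^] j"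
    by (intro conj_int_pow) (simp_all add: m_assoc)
  also have "(b \<otimes> inv c) [^] j = b [^] j \<otimes> (inv c) [^] j \<otimes> (inv v) [^] tri j"
  proof (rule mult_int_pow_class2)
    show "inv c \<otimes> b = b \<otimes> inv c \<otimes> inv v"
      using cb_swap[of "- 1" 1] by (simp add: int_pow_neg m_assoc)
    show "b \<otimes> inv v = inv v \<otimes> b" "inv c \<otimes> inv v = inv v \<otimes> inv c"
      using v_swap(2)[of "- 1" 1] v_swap(3)[of "- 1" "- 1"] by (simp_all add: int_pow_neg)
  qed simp_all
  also have "\<dots> = b [^] j \<otimes> (c [^] (- j) \<otimes> v [^] (- tri j))"
    by (simp add: int_pow_inv int_pow_neg m_assoc)
  finally have 1: "b [^] j \<otimes> a = a \<otimes> (b [^] j \<otimes> (c [^] (- j) \<otimes> v [^] (- tri j)))" .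
  have 2: "a \<otimes> c [^] (- j) \<otimes> v [^] (j * j - tri j) \<otimes> b [^] j = b [^] j \<otimes> a"
    unfolding 1
    by (simp add: m_assoc v_swap cb_swap commute_left[OF cb_swap] int_pow_mult[symmetric])
  have "b [^] j \<otimes> a [^] i = (a \<otimes> c [^] (- j) \<otimes> v [^] (j * j - tri j)) [^] i \<otimes> b [^] j"
    by (rule conj_int_pow[symmetric]) (simp_all add: 2)
  also have "(a \<otimes> c [^] (- j) \<otimes> v [^] (j * j - tri j)) [^] i =
      (a \<otimes> c [^] (- j)) [^] i \<otimes> v [^] ((j * j - tri j) * i)"
    using v_swap(1)[of _ 1] by (subst int_pow_mult_distrib)
      (simp_all add: int_pow_pow m_assoc v_swap commute_left[OF v_swap(1)[of _ 1, simplified]])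
  also have "(a \<otimes> c [^] (- j)) [^] i = a [^] i \<otimes> (c [^] (- j)) [^] i \<otimes> (u [^] j) [^] tri i"
  proof (rule mult_int_pow_class2)
    show "c [^] - j \<otimes> a = a \<otimes> c [^] - j \<otimes> u [^] j"
      using ca_swap[of "- j" 1] by (simp add: m_assoc)
    show "a \<otimes> u [^] j = u [^] j \<otimes> a"
      using u_swap(1)[of j 1] by simp
  qed (simp_all add: u_swap)
  finally show ?thesis
    by (simp add: m_assoc int_pow_pow v_swap u_swap cb_swap commute_left[OF v_swap(4)]
        commute_left[OF v_swap(2)] commute_left[OF v_swap(3)]
        commute_left[OF u_swap(2)] commute_left[OF cb_swap] int_pow_mult[symmetric] algebra_simps)
qed

definition collect :: "int \<times> int \<times> int \<times> int \<times> int \<Rightarrow> 'a" where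
  "collect = (\<lambda>(i, j, k, p, q). a [^] i \<otimes> (b [^] j \<otimes> (c [^] k \<otimes> (u [^] p \<otimes> v [^] q))))"

lemma int_pow_merge:
  fixes i j :: int
  assumes "x \<in> carrier G" "w \<in> carrier G"
  shows "x [^] i \<otimes> (x [^] j \<otimes> w) = x [^] (i + j) \<otimes> w"
  using assms by (simp add: int_pow_mult m_assoc)

text \<open>The universal property of \<open>nil3\<close>: the product formula of \<open>nil3\<close> is valid in every group of
this kind.\<close>

lemma collect_hom: "collect \<in> hom nil3 G"
proof (rule homI)
  fix x y
  show "collect (x \<otimes>\<^bsub>nil3\<^esub> y) = collect x \<otimes> collect y"
  proof (cases x, cases y)
    fix i j k p q i' j' k' p' q'
    assume "x = (i, j, k, p, q)" "y = (i', j', k', p', q')"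
    then show ?thesis
      by (simp add: collect_def mult_nil3 m_assoc pow_swap pow_swap[THEN commute_left]
        ba_swap ba_swap[THEN commute_left] int_pow_mult[symmetric] int_pow_merge)
        (simp add: algebra_simps)
  qed
qed (auto simp: collect_def)

end

section \<open>Pairs satisfying the relations\<close>

text \<open>The relations of \<open>K\<close> for \<open>a\<close> and \<open>b\<close>, with \<open>Q\<close> and \<open>r\<close> in the place of \<open>2\<^sup>m\<^sup>-\<^sup>1\<close> and \<open>\<ell>\<close>.
What the argument needs of these numbers is that \<open>Q\<close> is even, positive and coprime to \<open>r\<close>.\<close>

definition macdonald_rels :: "('g, 'h) monoid_scheme \<Rightarrow> 'g \<Rightarrow> 'g \<Rightarrow> int \<Rightarrow> int \<Rightarrow> bool" where
  "macdonald_rels G a b Q r \<longleftrightarrow>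
     (let c = inv\<^bsub>G\<^esub> a \<otimes>\<^bsub>G\<^esub> inv\<^bsub>G\<^esub> b \<otimes>\<^bsub>G\<^esub> a \<otimes>\<^bsub>G\<^esub> b in
       inv\<^bsub>G\<^esub> c \<otimes>\<^bsub>G\<^esub> a \<otimes>\<^bsub>G\<^esub> c = a [^]\<^bsub>G\<^esub> (1 + 2 * Q * r) \<and>
       c \<otimes>\<^bsub>G\<^esub> b \<otimes>\<^bsub>G\<^esub> inv\<^bsub>G\<^esub> c = b [^]\<^bsub>G\<^esub> (1 + 2 * Q * r) \<and>
       a [^]\<^bsub>G\<^esub> (2 * Q * Q) = \<one>\<^bsub>G\<^esub> \<and> b [^]\<^bsub>G\<^esub> (2 * Q * Q) = \<one>\<^bsub>G\<^esub> \<and> c [^]\<^bsub>G\<^esub> Q = \<one>\<^bsub>G\<^esub>)"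

lemma (in group) K_rels_iff:
  assumes "a \<in> carrier G" "b \<in> carrier G" "m > 0"
  defines "f \<equiv> (\<lambda>g. case g of GenA \<Rightarrow> a | GenB \<Rightarrow> b)"
  shows "(\<forall>(u, v) \<in> K_rels m l. weval G f u = weval G f v) \<longleftrightarrow>
    macdonald_rels G a b (2 ^ (m - 1)) l"
proof -
  have f: "range f \<subseteq> carrier G"
    using assms by (auto simp: f_def split: gen.split)
  have fs [simp]: "f GenA = a" "f GenB = b"
    by (simp_all add: f_def)
  have m: "2 * 2 ^ (m - Suc 0) = (2 ^ m :: int)"
    "2 ^ m * 2 ^ (m - Suc 0) = (2 ^ (2 * m - Suc 0) :: int)"
    using assms(3) by (simp_all add: power_add[symmetric] flip: power_Suc)
  have c: "inv b \<otimes> inv a \<otimes> b \<otimes> a = inv (inv a \<otimes> inv b \<otimes> a \<otimes> b)"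
    using assms(1,2) by (simp add: inv_mult_group m_assoc)
  have [simp]: "weval G f [] = \<one>"
    by simp
  show ?thesis
    using assms(1,2)
    by (simp add: K_rels_def macdonald_rels_def Let_def weval_wcomm[OF f] weval_wconj[OF f]
        weval_wpow[OF f] weval_wgen[OF f] m c del: weval.simps)
qed

text \<open>The reason why the group has class at most three. Put \<open>z = a\<^sup>2\<^sup>Q\<^sup>r = [a, c]\<close>, which has order
dividing \<open>Q\<close>. As \<open>z\<close> commutes with \<open>c\<close>, the elements \<open>a\<close> and \<open>c\<close> generate a group of class at
most two, in which \<open>(ac)\<^sup>2\<^sup>Q = a\<^sup>2\<^sup>Q c\<^sup>2\<^sup>Q z\<^sup>-\<^sup>Q\<^sup>(\<^sup>2\<^sup>Q\<^sup>-\<^sup>1\<^sup>) = a\<^sup>2\<^sup>Q\<close>. The left hand side is \<open>a\<^sup>2\<^sup>Q\<close> conjugated by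
\<open>b\<close>.\<close>

lemma (in group) pow_central_of_rel:
  fixes Q r :: int
  assumes [simp]: "a \<in> carrier G" "b \<in> carrier G" "c \<in> carrier G"
    and ab: "a \<otimes> b = b \<otimes> (a \<otimes> c)" and ac: "a \<otimes> c = c \<otimes> a [^] (1 + 2 * Q * r)"
    and a: "a [^] (2 * Q * Q) = \<one>" and c: "c [^] Q = \<one>"
  shows "a [^] (2 * Q * r) \<otimes> c = c \<otimes> a [^] (2 * Q * r)"
    and "a [^] (2 * Q) \<otimes> b = b \<otimes> a [^] (2 * Q)"
proof -
  define z where "z = a [^] (2 * Q * r)"
  have a1: "a [^] (2 * Q * Q * n) = \<one>" for n
    using a int_pow_pow[of a "2 * Q * Q" n] by simp
  have zz: "z [^] (Q * n) = \<one>" for n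
    using a1[of "r * n"] by (simp add: z_def int_pow_pow mult_ac)
  have [simp]: "z \<in> carrier G"
    by (simp add: z_def)
  have az: "a [^] (1 + 2 * Q * r) = a \<otimes> z" "a \<otimes> z = z \<otimes> a"
    using int_pow_mult[of a 1 "2 * Q * r"] int_pow_mult[of a "2 * Q * r" 1]
    by (simp_all add: z_def add.commute)
  have "z \<otimes> c = c \<otimes> (a \<otimes> z) [^] (2 * Q * r)"
    unfolding z_def by (rule conj_int_pow) (simp_all add: ac az(1) flip: z_def)
  also have "(a \<otimes> z) [^] (2 * Q * r) = z \<otimes> z [^] (2 * Q * r)"
    using az(2) by (subst int_pow_mult_distrib) (simp_all add: z_def)
  also have "z [^] (2 * Q * r) = \<one>"
    using zz[of "2 * r"] by (simp add: mult_ac)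
  finally have zc: "z \<otimes> c = c \<otimes> z"
    by simp
  then show "a [^] (2 * Q * r) \<otimes> c = c \<otimes> a [^] (2 * Q * r)"
    by (simp add: z_def)
  have "c \<otimes> a = a \<otimes> c \<otimes> inv z"
    using ac az(1) by (simp add: inv_solve_right m_assoc)
  then have "(a \<otimes> c) [^] (2 * Q) = a [^] (2 * Q) \<otimes> c [^] (2 * Q) \<otimes> inv z [^] tri (2 * Q)"
    using int_pow_comm[of a z 1 "- 1"] int_pow_comm[of c z 1 "- 1"] zc az(2)
    by (intro mult_int_pow_class2) (simp_all add: int_pow_neg)
  also have "c [^] (2 * Q) = \<one>"
    using c int_pow_pow[of c Q 2] by (simp add: mult.commute)
  also have "inv z [^] tri (2 * Q) = \<one>"
    using zz[of "2 * Q - 1"] by (simp add: int_pow_inv tri_double)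
  finally have "(a \<otimes> c) [^] (2 * Q) = a [^] (2 * Q)"
    by simp
  then show "a [^] (2 * Q) \<otimes> b = b \<otimes> a [^] (2 * Q)"
    using conj_int_pow[OF ab, of "2 * Q"] by simp
qed

locale macdonald_pair = group G for G (structure) +
  fixes a b :: 'a and Q r :: int
  assumes a_carr [simp]: "a \<in> carrier G" and b_carr [simp]: "b \<in> carrier G"
    and rels: "macdonald_rels G a b Q r"
begin

definition c :: 'a where "c = inv a \<otimes> inv b \<otimes> a \<otimes> b"

lemma c_carr [simp]: "c \<in> carrier G"
  by (simp add: c_def)

lemma a_conj_c: "inv c \<otimes> a \<otimes> c = a [^] (1 + 2 * Q * r)"
  and b_conj_c: "c \<otimes> b \<otimes> inv c = b [^] (1 + 2 * Q * r)"
  and a_order: "a [^] (2 * Q * Q) = \<one>"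
  and b_order: "b [^] (2 * Q * Q) = \<one>"
  and c_order: "c [^] Q = \<one>"
  using rels by (simp_all add: macdonald_rels_def Let_def c_def)

lemma ab_eq: "a \<otimes> b = b \<otimes> (a \<otimes> c)"
  by (simp add: c_def m_assoc[symmetric])

lemma ac_eq: "a \<otimes> c = c \<otimes> a [^] (1 + 2 * Q * r)"
  using a_conj_c by (simp add: inv_solve_left' m_assoc)

text \<open>The relations are symmetric under exchanging \<open>a\<close> and \<open>b\<close> and inverting \<open>c\<close>; the next two
facts are the mirror images of the previous two.\<close>

lemma ba_eq: "b \<otimes> a = a \<otimes> (b \<otimes> inv c)"
  using ab_eq by (simp add: inv_solve_right m_assoc[symmetric])

lemma b_inv_c_eq: "b \<otimes> inv c = inv c \<otimes> b [^] (1 + 2 * Q * r)"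
  using b_conj_c by (simp add: inv_solve_left m_assoc)

lemma a_pow_swap: "a [^] (2 * Q) \<otimes> b = b \<otimes> a [^] (2 * Q)"
  using pow_central_of_rel(2)[OF _ _ _ ab_eq ac_eq a_order c_order] by simp

lemma b_pow_swap: "b [^] (2 * Q) \<otimes> a = a \<otimes> b [^] (2 * Q)"
  using pow_central_of_rel(2)[OF _ _ _ ba_eq b_inv_c_eq b_order] c_order
  by (simp add: int_pow_inv)

sublocale class3_pair G a b c "a [^] (2 * Q * r)" "b [^] (2 * Q * r)"
proof
  show "a \<otimes> b = b \<otimes> a \<otimes> c"
    by (simp add: ab_eq m_assoc)
  show "a \<otimes> c = c \<otimes> a \<otimes> a [^] (2 * Q * r)"
    using int_pow_mult[of a 1 "2 * Q * r"] by (simp add: ac_eq m_assoc)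
  have "b [^] (2 * Q * r) \<otimes> inv c = inv c \<otimes> b [^] (2 * Q * r)"
    using pow_central_of_rel(1)[OF _ _ _ ba_eq b_inv_c_eq b_order] c_order
    by (simp add: int_pow_inv)
  then have "b [^] (2 * Q * r) \<otimes> c = c \<otimes> b [^] (2 * Q * r)"
    using int_pow_comm[of "b [^] (2 * Q * r)" "inv c" 1 "- 1"] by (simp add: int_pow_neg)
  moreover have "c \<otimes> b = b [^] (1 + 2 * Q * r) \<otimes> c"
    using b_conj_c by (simp add: inv_solve_right')
  ultimately show "c \<otimes> b = b \<otimes> c \<otimes> b [^] (2 * Q * r)"
    using int_pow_mult[of b 1 "2 * Q * r"] by (simp add: m_assoc)
  show "a \<otimes> a [^] (2 * Q * r) = a [^] (2 * Q * r) \<otimes> a"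
    "b \<otimes> b [^] (2 * Q * r) = b [^] (2 * Q * r) \<otimes> b"
    using int_pow_comm[of a a 1 "2 * Q * r"] int_pow_comm[of b b 1 "2 * Q * r"] by simp_all
  show "b \<otimes> a [^] (2 * Q * r) = a [^] (2 * Q * r) \<otimes> b"
    using int_pow_comm[of "a [^] (2 * Q)" b r 1] a_pow_swap by (simp add: int_pow_pow)
  show "a \<otimes> b [^] (2 * Q * r) = b [^] (2 * Q * r) \<otimes> a"
    using int_pow_comm[of "b [^] (2 * Q)" a r 1] b_pow_swap by (simp add: int_pow_pow)
qed simp_all

definition nf :: "int \<Rightarrow> int \<Rightarrow> int \<Rightarrow> 'a" where
  "nf i j k = a [^] i \<otimes> (b [^] j \<otimes> c [^] k)"

lemma nf_carr [simp]: "nf i j k \<in> carrier G"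
  by (simp add: nf_def)

text \<open>Here \<open>[a, c]\<close> and \<open>[c, b]\<close> are powers of \<open>a\<close> and \<open>b\<close>, so three exponents suffice.\<close>

lemma collect_eq_nf: "collect (i, j, k, p, q) = nf (i + 2 * Q * r * p) (j + 2 * Q * r * q) k"
proof -
  have "collect (i, j, k, p, q) = a [^] i \<otimes> ((a [^] (2 * Q * r)) [^] p \<otimes>
      (b [^] j \<otimes> ((b [^] (2 * Q * r)) [^] q \<otimes> c [^] k)))"
    unfolding collect_def prod.case
    by (simp only: m_assoc u_swap v_swap commute_left[OF u_swap(2)] commute_left[OF u_swap(3)]
        carr int_pow_closed m_closed)
  then show ?thesis
    by (simp add: nf_def int_pow_pow int_pow_mult m_assoc)
qed

lemma nf_mult: "nf i j k \<otimes> nf i' j' k' =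
    nf (i + i' + 2 * Q * r * (j * tri i' - k * i'))
       (j + j' + 2 * Q * r * (k * j' - i' * tri j - i' * j * j')) (k + k' - i' * j)"
proof -
  have "nf i j k \<otimes> nf i' j' k' = collect (i, j, k, 0, 0) \<otimes> collect (i', j', k', 0, 0)"
    by (simp add: collect_eq_nf)
  also have "\<dots> = collect ((i, j, k, 0, 0) \<otimes>\<^bsub>nil3\<^esub> (i', j', k', 0, 0))"
    by (rule hom_mult[OF collect_hom, symmetric]) simp_all
  finally show ?thesis
    by (simp add: mult_nil3 collect_eq_nf) (simp add: algebra_simps)
qed

lemma nf_simps:
  "nf 0 0 0 = \<one>" "nf 1 0 0 = a" "nf 0 1 0 = b" "nf 0 0 1 = c"
  "nf i 0 0 = a [^] i" "nf 0 j 0 = b [^] j" "nf 0 0 k = c [^] k"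
  by (simp_all add: nf_def)

lemma nf_period:
  assumes "2 * Q * Q dvd i - i'" "2 * Q * Q dvd j - j'" "Q dvd k - k'"
  shows "nf i j k = nf i' j' k'"
proof -
  have *: "x [^] (i :: int) = x [^] i'" if "x \<in> carrier G" "x [^] d = \<one>" and d: "d dvd i - i'"
    for x :: 'a and i i' d :: int
  proof -
    obtain n where "i = d * n + i'"
      using d by (metis diff_add_cancel dvdE)
    then show ?thesis
      using that(1,2) int_pow_pow[of x d n] by (simp add: int_pow_mult)
  qed
  show ?thesis
    using *[of a] *[of b] *[of c] a_order b_order c_order assms by (simp add: nf_def)
qed

end

section \<open>A model in which the normal form is unique\<close>

text \<open>The tuples that represent the identity in every group satisfying the relations of \<open>K\<close>: by
\<open>u = a\<^sup>2\<^sup>Q\<^sup>r\<close> and \<open>v = b\<^sup>2\<^sup>Q\<^sup>r\<close> a tuple \<open>(i, j, k, p, q)\<close> has the value of \<open>a\<close> to the \<open>i + 2Qrp\<close>,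
times \<open>b\<close> to the \<open>j + 2Qrq\<close>, times \<open>c\<^sup>k\<close>.\<close>

definition nil3_lattice :: "int \<Rightarrow> int \<Rightarrow> (int \<times> int \<times> int \<times> int \<times> int) set" where
  "nil3_lattice Q r = {(i, j, k, p, q).
     2 * Q * Q dvd i + 2 * Q * r * p \<and> 2 * Q * Q dvd j + 2 * Q * r * q \<and> Q dvd k}"

lemma mem_nil3_lattice:
  "(i, j, k, p, q) \<in> nil3_lattice Q r \<longleftrightarrow>
     2 * Q * Q dvd i + 2 * Q * r * p \<and> 2 * Q * Q dvd j + 2 * Q * r * q \<and> Q dvd k"
  by (simp add: nil3_lattice_def)

lemma nil3_latticeE:
  assumes "(i, j, k, p, q) \<in> nil3_lattice Q r"
  obtains i' j' k' where "i = 2 * Q * i'" "j = 2 * Q * j'" "k = Q * k'"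
proof -
  have "2 * Q dvd i"
  proof -
    have "2 * Q dvd i + 2 * Q * r * p"
      using assms by (auto simp: mem_nil3_lattice intro: dvd_trans[of _ "2 * Q * Q"])
    then have "2 * Q dvd (i + 2 * Q * r * p) - 2 * Q * r * p"
      by (intro dvd_diff) (simp_all add: mult.assoc)
    then show ?thesis by simp
  qed
  moreover have "2 * Q dvd j"
  proof -
    have "2 * Q dvd j + 2 * Q * r * q"
      using assms by (auto simp: mem_nil3_lattice intro: dvd_trans[of _ "2 * Q * Q"])
    then have "2 * Q dvd (j + 2 * Q * r * q) - 2 * Q * r * q"
      by (intro dvd_diff) (simp_all add: mult.assoc)
    then show ?thesis by simp
  qed
  moreover have "Q dvd k"
    using assms by (simp add: mem_nil3_lattice)
  ultimately show thesis
    by (auto elim!: dvdE intro: that)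
qed

lemma dvd_add_multiple_iff:
  fixes x y d :: int
  assumes "d dvd y - x"
  shows "d dvd y \<longleftrightarrow> d dvd x"
  using assms by (metis add.commute diff_add_cancel dvd_add_left_iff dvd_add_right_iff)

text \<open>For an element of the lattice \<open>2Q\<close> divides \<open>i\<close> and \<open>j\<close>, and \<open>Q\<close> divides \<open>k\<close>. Hence every
correction term in \<open>p\<close> or \<open>q\<close> that arises in a product, an inverse or a conjugate is a multiple
of \<open>Q\<close>, and changes the first two conditions by a multiple of \<open>2Q \<cdot> Q\<close>.\<close>

lemma nil3_lattice_normal: "nil3_lattice Q r \<lhd> nil3"
proof -
  interpret group nil3
    by (rule group_nil3)
  have tri2: "tri (2 * Q * x) = Q * x * (2 * Q * x - 1)" for x
    using tri_double[of "Q * x"] by (simp add: mult.assoc)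
  \<comment> \<open>In each use \<open>Q * s\<close> is the correction term of the exponent of \<open>u\<close> or \<open>v\<close>.\<close>
  have *: "2 * Q * Q dvd y \<longleftrightarrow> 2 * Q * Q dvd x" if "y - x = 2 * Q * r * (Q * s)" for x y s
    by (rule dvd_add_multiple_iff) (simp add: that)
  show ?thesis
  proof (subst normal_inv_iff, intro conjI ballI subgroupI)
    show "nil3_lattice Q r \<noteq> {}"
      using mem_nil3_lattice[of 0 0 0 0 0] by force
  next
    fix x assume x: "x \<in> nil3_lattice Q r"
    obtain i j k p q where [simp]: "x = (i, j, k, p, q)"
      by (cases x)
    obtain i' j' k' where e: "i = 2 * Q * i'" "j = 2 * Q * j'" "k = Q * k'"
      using x by simp (elim nil3_latticeE, blast)
    have 1: "2 * Q * Q dvd - (i + 2 * Q * r * p)" "2 * Q * Q dvd - (j + 2 * Q * r * q)"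
      using x unfolding dvd_minus_iff by (simp_all add: mem_nil3_lattice)
    have "2 * Q * Q dvd - i + 2 * Q * r * (- p - j * tri (- i) - k * i)"
      by (rule *[where s = "- 2 * j' * tri (- i) - k' * i", THEN iffD2, OF _ 1(1)])
        (simp add: e algebra_simps)
    moreover have "2 * Q * Q dvd - j + 2 * Q * r * (- q - i * tri j + i * (j * j) + k * j)"
      by (rule *[where s = "- 2 * i' * tri j + 2 * i' * (j * j) + k' * j", THEN iffD2, OF _ 1(2)])
        (simp add: e algebra_simps)
    ultimately show "inv\<^bsub>nil3\<^esub> x \<in> nil3_lattice Q r"
      by (simp add: inv_nil3 mem_nil3_lattice) (simp add: e)
  next
    fix x y assume x: "x \<in> nil3_lattice Q r" and y: "y \<in> nil3_lattice Q r"
    obtain i j k p q where [simp]: "x = (i, j, k, p, q)"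
      by (cases x)
    obtain u v w s t where [simp]: "y = (u, v, w, s, t)"
      by (cases y)
    obtain i' j' k' where e: "i = 2 * Q * i'" "j = 2 * Q * j'" "k = Q * k'"
      using x by simp (elim nil3_latticeE, blast)
    obtain u' v' w' where f: "u = 2 * Q * u'" "v = 2 * Q * v'" "w = Q * w'"
      using y by simp (elim nil3_latticeE, blast)
    have 1: "2 * Q * Q dvd (i + 2 * Q * r * p) + (u + 2 * Q * r * s)"
      "2 * Q * Q dvd (j + 2 * Q * r * q) + (v + 2 * Q * r * t)"
      using x y by (simp_all add: mem_nil3_lattice)
    have "2 * Q * Q dvd i + u + 2 * Q * r * (p + s + j * tri u - k * u)"
      by (rule *[where s = "2 * j' * tri u - k' * u", THEN iffD2, OF _ 1(1)])
        (simp add: e algebra_simps)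
    moreover have "2 * Q * Q dvd j + v + 2 * Q * r * (q + t - u * tri j - u * j * v + k * v)"
      by (rule *[where s = "- 2 * u' * tri j - 2 * u' * j * v + k' * v", THEN iffD2, OF _ 1(2)])
        (simp add: e(3) f(1) algebra_simps)
    ultimately show "x \<otimes>\<^bsub>nil3\<^esub> y \<in> nil3_lattice Q r"
      by (simp add: mult_nil3 mem_nil3_lattice) (simp add: e f)
  next
    fix y x :: "int \<times> int \<times> int \<times> int \<times> int"
    assume x: "x \<in> nil3_lattice Q r"
    obtain i j k p q where [simp]: "x = (i, j, k, p, q)"
      by (cases x)
    obtain u v w s t where [simp]: "y = (u, v, w, s, t)"
      by (cases y)
    obtain i' j' k' where e: "i = 2 * Q * i'" "j = 2 * Q * j'" "k = Q * k'"
      using x by simp (elim nil3_latticeE, blast)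
    \<comment> \<open>\<open>Q * P\<close> and \<open>Q * P'\<close> are the changes of the exponents of \<open>u\<close> and \<open>v\<close> under conjugation
      by \<open>y\<close>, divided by \<open>Q\<close> with the help of \<open>e\<close> and \<open>tri2\<close>.\<close>
    define P where "P = v * i' * (2 * Q * i' - 1) - 2 * w * i' + 2 * j' * tri (- u) + k' * u
      - 2 * i' * u * v"
    define P' where "P' = u * j' * (2 * Q * j' - 1) + 2 * w * j' - 2 * i' * tri v - k' * v
      + 2 * i' * v * v - 2 * i' * v * j"
    have "y \<otimes>\<^bsub>nil3\<^esub> x \<otimes>\<^bsub>nil3\<^esub> inv\<^bsub>nil3\<^esub> y = (i, j, k - i * v + u * j,
        p + (v * tri i - w * i + j * tri (- u) + k * u - i * u * v),
        q + (u * tri j + w * j - i * tri v - k * v + i * v * v - i * v * j))"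
      by (simp add: mult_nil3 inv_nil3 tri_add) (simp add: algebra_simps)
    also have "v * tri i - w * i + j * tri (- u) + k * u - i * u * v = Q * P"
      by (simp add: P_def e tri2) (simp add: algebra_simps)
    also have "u * tri j + w * j - i * tri v - k * v + i * v * v - i * v * j = Q * P'"
      by (simp add: P'_def e(2,3) tri2) (simp add: e(1) algebra_simps)
    finally have eq: "y \<otimes>\<^bsub>nil3\<^esub> x \<otimes>\<^bsub>nil3\<^esub> inv\<^bsub>nil3\<^esub> y =
        (i, j, k - i * v + u * j, p + Q * P, q + Q * P')" .
    have 1: "2 * Q * Q dvd i + 2 * Q * r * p" "2 * Q * Q dvd j + 2 * Q * r * q"
      using x by (simp_all add: mem_nil3_lattice)
    have "2 * Q * Q dvd i + 2 * Q * r * (p + Q * P)"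
      by (rule *[where s = P, THEN iffD2, OF _ 1(1)]) (simp add: algebra_simps)
    moreover have "2 * Q * Q dvd j + 2 * Q * r * (q + Q * P')"
      by (rule *[where s = P', THEN iffD2, OF _ 1(2)]) (simp add: algebra_simps)
    ultimately show "y \<otimes>\<^bsub>nil3\<^esub> x \<otimes>\<^bsub>nil3\<^esub> inv\<^bsub>nil3\<^esub> y \<in> nil3_lattice Q r"
      unfolding eq mem_nil3_lattice by (simp add: e)
  qed simp
qed

lemma nil3_pow:
  fixes n :: int
  shows "(1, 0, 0, 0, 0) [^]\<^bsub>nil3\<^esub> n = (n, 0, 0, 0, 0)"
    and "(0, 1, 0, 0, 0) [^]\<^bsub>nil3\<^esub> n = (0, n, 0, 0, 0)"
    and "(0, 0, 1, 0, 0) [^]\<^bsub>nil3\<^esub> n = (0, 0, n, 0, 0)"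
  by (rule group.int_pow_unique[OF group_nil3]; simp add: one_nil3 mult_nil3)+

definition nil3_coset :: "int \<Rightarrow> int \<Rightarrow> int \<times> int \<times> int \<times> int \<times> int \<Rightarrow> _ set" where
  "nil3_coset Q r x = nil3_lattice Q r #>\<^bsub>nil3\<^esub> x"

lemma nil3_coset_hom: "group_hom nil3 (nil3 Mod nil3_lattice Q r) (nil3_coset Q r)"
proof -
  interpret normal "nil3_lattice Q r" nil3
    by (rule nil3_lattice_normal)
  show ?thesis
    using r_coset_hom_Mod factorgroup_is_group
    by (simp add: group_hom_def group_hom_axioms_def nil3_coset_def[abs_def] is_group)
qed

lemma nil3_coset_eqI:
  assumes "x \<otimes>\<^bsub>nil3\<^esub> inv\<^bsub>nil3\<^esub> y \<in> nil3_lattice Q r"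
  shows "nil3_coset Q r x = nil3_coset Q r y"
proof -
  interpret N: normal "nil3_lattice Q r" nil3
    by (rule nil3_lattice_normal)
  have "x \<in> nil3_lattice Q r #>\<^bsub>nil3\<^esub> y"
    using assms N.rcos_module[OF N.is_group, of y x] by simp
  then show ?thesis
    using N.repr_independence[OF _ _ N.subgroup_axioms] by (simp add: nil3_coset_def)
qed

lemma nil3_coset_eq_one:
  "nil3_coset Q r x = \<one>\<^bsub>nil3 Mod nil3_lattice Q r\<^esub> \<longleftrightarrow> x \<in> nil3_lattice Q r"
proof -
  interpret N: normal "nil3_lattice Q r" nil3
    by (rule nil3_lattice_normal)
  show ?thesis
    using N.coset_join1[OF _ _ N.subgroup_axioms, of x] N.coset_join2[OF _ N.subgroup_axioms, of x]
    by (auto simp: nil3_coset_def)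
qed

context
  fixes Q r :: int
begin

private abbreviation (input) "H \<equiv> nil3 Mod nil3_lattice Q r"
private abbreviation (input) "\<pi> \<equiv> nil3_coset Q r"

lemma nil3_coset_simps:
  fixes n :: int
  shows "\<pi> x \<otimes>\<^bsub>H\<^esub> \<pi> y = \<pi> (x \<otimes>\<^bsub>nil3\<^esub> y)"
    and "inv\<^bsub>H\<^esub> \<pi> x = \<pi> (inv\<^bsub>nil3\<^esub> x)"
    and "\<pi> x [^]\<^bsub>H\<^esub> n = \<pi> (x [^]\<^bsub>nil3\<^esub> n)"
proof -
  interpret \<pi>: group_hom nil3 H \<pi>
    by (rule nil3_coset_hom)
  show "\<pi> x \<otimes>\<^bsub>H\<^esub> \<pi> y = \<pi> (x \<otimes>\<^bsub>nil3\<^esub> y)" "inv\<^bsub>H\<^esub> \<pi> x = \<pi> (inv\<^bsub>nil3\<^esub> x)"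
    "\<pi> x [^]\<^bsub>H\<^esub> n = \<pi> (x [^]\<^bsub>nil3\<^esub> n)"
    using \<pi>.hom_mult[of x y] \<pi>.hom_inv[of x] \<pi>.hom_int_pow[of x n] by simp_all
qed

lemma nil3_coset_commutator:
  "inv\<^bsub>H\<^esub> \<pi> (1, 0, 0, 0, 0) \<otimes>\<^bsub>H\<^esub> inv\<^bsub>H\<^esub> \<pi> (0, 1, 0, 0, 0) \<otimes>\<^bsub>H\<^esub> \<pi> (1, 0, 0, 0, 0)
     \<otimes>\<^bsub>H\<^esub> \<pi> (0, 1, 0, 0, 0) = \<pi> (0, 0, 1, 0, 0)"
  unfolding nil3_coset_simps by (simp add: mult_nil3 inv_nil3 tri_minus)

lemma macdonald_rels_nil3_coset: "macdonald_rels H (\<pi> (1, 0, 0, 0, 0)) (\<pi> (0, 1, 0, 0, 0)) Q r"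
proof -
  let ?a = "(1, 0, 0, 0, 0)" and ?b = "(0, 1, 0, 0, 0)" and ?c = "(0, 0, 1, 0, 0)"
  have "inv\<^bsub>H\<^esub> \<pi> ?c \<otimes>\<^bsub>H\<^esub> \<pi> ?a \<otimes>\<^bsub>H\<^esub> \<pi> ?c = \<pi> ?a [^]\<^bsub>H\<^esub> (1 + 2 * Q * r)"
    unfolding nil3_coset_simps nil3_pow
    by (rule nil3_coset_eqI) (simp add: mult_nil3 inv_nil3 mem_nil3_lattice)
  moreover have "\<pi> ?c \<otimes>\<^bsub>H\<^esub> \<pi> ?b \<otimes>\<^bsub>H\<^esub> inv\<^bsub>H\<^esub> \<pi> ?c = \<pi> ?b [^]\<^bsub>H\<^esub> (1 + 2 * Q * r)"
    unfolding nil3_coset_simps nil3_pow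
    by (rule nil3_coset_eqI) (simp add: mult_nil3 inv_nil3 mem_nil3_lattice)
  moreover have "\<pi> ?a [^]\<^bsub>H\<^esub> (2 * Q * Q) = \<one>\<^bsub>H\<^esub>" "\<pi> ?b [^]\<^bsub>H\<^esub> (2 * Q * Q) = \<one>\<^bsub>H\<^esub>"
    "\<pi> ?c [^]\<^bsub>H\<^esub> Q = \<one>\<^bsub>H\<^esub>"
    unfolding nil3_coset_simps nil3_pow nil3_coset_eq_one by (simp_all add: mem_nil3_lattice)
  ultimately show ?thesis
    unfolding macdonald_rels_def Let_def nil3_coset_commutator by blast
qed

end

section \<open>The centre and the second centre\<close>

text \<open>The last two assumptions express that \<open>a\<close> and \<open>b\<close> generate the group and that the normal
form is unique. They are stated for a fixed group because a universal property that ranges over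
all groups cannot be an assumption of a locale; both are derived from the presentation at the
end.\<close>

locale macdonald_group = macdonald_pair +
  assumes Q_pos: "Q > 0" and Q_even: "even Q" and Q_coprime: "coprime Q r"
    and generated: "x \<in> carrier G \<Longrightarrow> \<exists>w. x = weval G (case_gen a b) w"
    and nf_one: "nf i j k = \<one> \<Longrightarrow> 2 * Q * Q dvd i \<and> 2 * Q * Q dvd j \<and> Q dvd k"
begin

lemma nf_exhaust:
  assumes "x \<in> carrier G"
  obtains i j k where "x = nf i j k"
proof -
  define e :: "gen \<Rightarrow> int \<times> int \<times> int \<times> int \<times> int"
    where "e = case_gen (1, 0, 0, 0, 0) (0, 1, 0, 0, 0)"
  have e: "collect \<circ> e = case_gen a b"
    by (auto simp: e_def collect_eq_nf nf_simps split: gen.split)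
  obtain w where "x = weval G (case_gen a b) w"
    using generated assms by blast
  also have "\<dots> = collect (weval nil3 e w)"
    using weval_hom[OF group_nil3 is_group collect_hom, of e w] by (simp add: e)
  finally show thesis
    by (cases "weval nil3 e w") (auto simp: collect_eq_nf intro: that)
qed

lemma nf_eqD:
  assumes "nf i j k = nf i' j' k'"
  shows "2 * Q * Q dvd i - i'" "2 * Q * Q dvd j - j'" "Q dvd k - k'"
proof -
  have "\<one> = a [^] (- i') \<otimes> nf i j k \<otimes> c [^] (- k') \<otimes> b [^] (- j')"
    unfolding assms by (simp add: nf_def m_assoc int_pow_neg)
  also have "\<dots> = nf (- i') 0 0 \<otimes> nf i j k \<otimes> nf 0 0 (- k') \<otimes> nf 0 (- j') 0"
    by (simp add: nf_simps)
  also have "\<dots> = nf (i - i') (j - j' + 2 * Q * r * ((k - k') * - j')) (k - k')"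
    by (simp add: nf_mult algebra_simps)
  finally have *: "2 * Q * Q dvd i - i'" "2 * Q * Q dvd j - j' + 2 * Q * r * ((k - k') * - j')"
      "Q dvd k - k'"
    using nf_one by metis+
  then show "2 * Q * Q dvd i - i'" "Q dvd k - k'"
    by auto
  then obtain n where "k - k' = Q * n"
    by auto
  then have "2 * Q * Q dvd 2 * Q * r * ((k - k') * - j')"
    by (intro dvdI[of _ _ "- r * n * j'"]) simp
  then show "2 * Q * Q dvd j - j'"
    using *(2) by (metis dvd_add_left_iff)
qed

lemma dvd_cancel_2Qr: "2 * Q * Q dvd 2 * Q * r * n \<longleftrightarrow> Q dvd n"
  using Q_pos Q_coprime by (simp add: mult.assoc coprime_dvd_mult_right_iff)

text \<open>From \<open>Q\<close> dividing \<open>i\<close> it follows that \<open>i - 1\<close> is coprime to \<open>Q\<close>, and as \<open>Q\<close> is even also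
to \<open>2Q\<close>, which divides \<open>i (i - 1)\<close>.\<close>

lemma dvd_of_tri:
  assumes "Q dvd i" "Q dvd tri i"
  shows "2 * Q dvd i"
proof -
  have "coprime d (i - 1)" if "d dvd i" for d
  proof -
    have "coprime i (i - 1)"
      by simp
    then show ?thesis
      using that coprime_divisors[of d i "i - 1" "i - 1"] by simp
  qed
  then have "coprime (2 * Q) (i - 1)"
    using assms(1) Q_even by (auto intro: dvd_trans)
  moreover have "2 * Q dvd i * (i - 1)"
    using assms(2) by (simp flip: two_tri)
  ultimately show ?thesis
    by (simp add: coprime_dvd_mult_left_iff)
qed

definition central_elt :: "int \<Rightarrow> int \<Rightarrow> 'a" where
  "central_elt s t = nf (2 * Q * s) (2 * Q * t) 0"

lemma central_elt_central: "central_elt s t \<otimes> x = x \<otimes> central_elt s t" if "x \<in> carrier G"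
proof -
  obtain i j k where x: "x = nf i j k"
    using nf_exhaust \<open>x \<in> carrier G\<close> .
  have tri2: "tri (2 * Q * n) = Q * (n * (2 * Q * n - 1))" for n
    using tri_double[of "Q * n"] by (simp add: mult.assoc)
  show ?thesis
    unfolding x central_elt_def nf_mult
  proof (rule nf_period)
    show "2 * Q * Q dvd 2 * Q * s + i + 2 * Q * r * (2 * Q * t * tri i - 0 * i)
        - (i + 2 * Q * s + 2 * Q * r * (j * tri (2 * Q * s) - k * (2 * Q * s)))"
      by (rule dvdI[of _ _ "r * (2 * t * tri i - j * (s * (2 * Q * s - 1)) + 2 * k * s)"])
        (simp add: tri2, simp add: algebra_simps)
    show "2 * Q * Q dvd 2 * Q * t + j + 2 * Q * r * (0 * j - i * tri (2 * Q * t) - i * (2 * Q * t) * j)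
        - (j + 2 * Q * t + 2 * Q * r * (k * (2 * Q * t) - 2 * Q * s * tri j - 2 * Q * s * j * (2 * Q * t)))"
      by (rule dvdI[of _ _ "r * (2 * s * tri j + 4 * Q * s * t * j - i * (t * (2 * Q * t - 1))
          - 2 * i * t * j - 2 * k * t)"]) (simp add: tri2, simp add: algebra_simps)
    show "Q dvd 0 + k - i * (2 * Q * t) - (k + 0 - 2 * Q * s * j)"
      by (rule dvdI[of _ _ "2 * s * j - 2 * i * t"]) (simp add: algebra_simps)
  qed
qed

text \<open>In the product formula, comparing \<open>xa\<close> with \<open>ax\<close> yields \<open>Q\<close> dividing \<open>j\<close>, \<open>tri j\<close> and \<open>k\<close>,
and comparing \<open>xb\<close> with \<open>bx\<close> yields \<open>Q\<close> dividing \<open>i\<close> and \<open>tri i\<close>. The factor \<open>r\<close> in front of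
\<open>tri i\<close>, \<open>tri j\<close> and \<open>k\<close> cancels because it is coprime to \<open>Q\<close>.\<close>

lemma centralE:
  assumes "x \<in> carrier G" "x \<otimes> a = a \<otimes> x" "x \<otimes> b = b \<otimes> x"
  obtains s t where "x = central_elt s t"
proof -
  obtain i j k where x: "x = nf i j k"
    using nf_exhaust assms(1) .
  have "nf i j k \<otimes> nf 1 0 0 = nf 1 0 0 \<otimes> nf i j k"
    "nf i j k \<otimes> nf 0 1 0 = nf 0 1 0 \<otimes> nf i j k"
    using assms by (simp_all add: x nf_simps)
  note eqs = this[unfolded nf_mult, THEN nf_eqD(1)] this[unfolded nf_mult, THEN nf_eqD(2)]
    this[unfolded nf_mult, THEN nf_eqD(3)]
  have "Q dvd j" "Q dvd i"
    using eqs(5,6) by simp_all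
  moreover have "Q dvd tri j" "Q dvd tri i"
    using eqs(2,3) dvd_cancel_2Qr[of "tri j"] dvd_cancel_2Qr[of "tri i"] by simp_all
  ultimately have "2 * Q dvd i" "2 * Q dvd j"
    by (simp_all add: dvd_of_tri)
  moreover have "Q dvd k"
    using eqs(1) dvd_cancel_2Qr[of k] by simp
  ultimately show thesis
    using that nf_period[of i i j j k 0] by (auto simp: x central_elt_def elim!: dvdE)
qed

lemma central_elt_carr [simp]: "central_elt s t \<in> carrier G"
  by (simp add: central_elt_def)

lemma center_eq: "center G = range (\<lambda>(s, t). central_elt s t)"
proof (intro equalityI subsetI)
  fix x assume "x \<in> center G"
  then have "x \<in> carrier G" "x \<otimes> a = a \<otimes> x" "x \<otimes> b = b \<otimes> x"
    by (auto simp: center_def)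
  then show "x \<in> range (\<lambda>(s, t). central_elt s t)"
    by (rule centralE) auto
qed (auto simp: center_def central_elt_central)

lemma center_pow_Q:
  assumes "x \<in> center G"
  shows "x [^] Q = \<one>"
proof -
  obtain s t where x: "x = a [^] (2 * Q * s) \<otimes> b [^] (2 * Q * t)"
    using assms by (auto simp: center_eq central_elt_def nf_def)
  have "central_elt s 0 \<otimes> b [^] (2 * Q * t) = b [^] (2 * Q * t) \<otimes> central_elt s 0"
    by (rule central_elt_central) simp
  then have "x [^] Q = (a [^] (2 * Q * s)) [^] Q \<otimes> (b [^] (2 * Q * t)) [^] Q"
    unfolding x by (intro int_pow_mult_distrib) (simp_all add: central_elt_def nf_simps)
  also have "\<dots> = a [^] (2 * Q * Q * s) \<otimes> b [^] (2 * Q * Q * t)"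
    by (simp add: int_pow_pow mult_ac)
  also have "\<dots> = \<one>"
    by (simp add: int_pow_pow[of a "2 * Q * Q" s, symmetric] a_order
        int_pow_pow[of b "2 * Q * Q" t, symmetric] b_order)
  finally show ?thesis .
qed

lemma card_center: "card (center G) = nat Q ^ 2"
proof -
  have "bij_betw (\<lambda>(s, t). central_elt s t) ({0..<Q} \<times> {0..<Q}) (center G)"
    unfolding bij_betw_def
  proof
    show "inj_on (\<lambda>(s, t). central_elt s t) ({0..<Q} \<times> {0..<Q})"
    proof (rule inj_onI, clarify)
      fix s t s' t'
      assume *: "s \<in> {0..<Q}" "t \<in> {0..<Q}" "s' \<in> {0..<Q}" "t' \<in> {0..<Q}" "central_elt s t = central_elt s' t'"
      have "2 * Q * Q dvd 2 * Q * (s - s')" "2 * Q * Q dvd 2 * Q * (t - t')"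
        using nf_eqD(1,2)[OF *(5)[unfolded central_elt_def]] by (simp_all add: algebra_simps)
      then have "Q dvd s - s'" "Q dvd t - t'"
        using Q_pos by simp_all
      then show "s = s' \<and> t = t'"
        using *(1-4) by (metis atLeastLessThan_iff mod_eq_dvd_iff mod_pos_pos_trivial)
    qed
    have "central_elt s t = central_elt (s mod Q) (t mod Q)" for s t
      unfolding central_elt_def using Q_pos
      by (intro nf_period) (simp_all add: right_diff_distrib[symmetric] mult.assoc)
    then show "(\<lambda>(s, t). central_elt s t) ` ({0..<Q} \<times> {0..<Q}) = center G"
      using Q_pos by (auto simp: center_eq image_iff) (metis pos_mod_bound pos_mod_sign atLeastLessThan_iff mem_Sigma_iff case_prod_conv)
  qed
  then show ?thesis
    by (simp add: bij_betw_same_card[symmetric] power2_eq_square)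
qed

text \<open>In the normal forms of \<open>xa\<close> and \<open>ax\<close> the exponents of \<open>c\<close> differ by \<open>j\<close>, in those of \<open>xb\<close>
and \<open>bx\<close> by \<open>i\<close>, and central factors do not change these exponents modulo \<open>Q\<close>.\<close>

lemma second_centerE:
  assumes "x \<in> carrier G" "\<And>y. y \<in> carrier G \<Longrightarrow> \<exists>w \<in> center G. x \<otimes> y = w \<otimes> (y \<otimes> x)"
  obtains i j k where "x = nf (Q * i) (Q * j) k"
proof -
  obtain i j k where x: "x = nf i j k"
    using nf_exhaust assms(1) .
  have *: "\<exists>s t. x \<otimes> y = central_elt s t \<otimes> (y \<otimes> x)" if "y \<in> carrier G" for y
    using assms(2)[OF that] by (auto simp: center_eq)
  obtain s t where "nf i j k \<otimes> nf 1 0 0 = central_elt s t \<otimes> (nf 1 0 0 \<otimes> nf i j k)"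
    using *[OF nf_carr] x by metis
  then have "Q dvd k - j - (k - (1 + i) * (2 * Q * t))"
    unfolding central_elt_def nf_mult by (drule_tac nf_eqD(3)) (simp add: algebra_simps)
  then have "Q dvd k - j - (k - (1 + i) * (2 * Q * t)) - (1 + i) * (2 * Q * t)"
    by (rule dvd_diff) simp
  then have "Q dvd j"
    by simp
  obtain s' t' where "nf i j k \<otimes> nf 0 1 0 = central_elt s' t' \<otimes> (nf 0 1 0 \<otimes> nf i j k)"
    using *[OF nf_carr] x by metis
  then have "Q dvd k - (k - i - (i + 2 * Q * r * tri i) * (2 * Q * t'))"
    unfolding central_elt_def nf_mult by (drule_tac nf_eqD(3)) (simp add: algebra_simps)
  then have "Q dvd k - (k - i - (i + 2 * Q * r * tri i) * (2 * Q * t')) - (i + 2 * Q * r * tri i) * (2 * Q * t')"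
    by (rule dvd_diff) simp
  then have "Q dvd i"
    by simp
  then show thesis
    using \<open>Q dvd j\<close> that x by (auto elim!: dvdE)
qed

end

section \<open>Central automorphisms\<close>

lemma carrier_AutoGroup: "carrier (AutoGroup G) = auto G"
  by (simp add: AutoGroup_def)

lemma mult_AutoGroup:
  assumes "\<phi> \<in> auto G" "\<psi> \<in> auto G"
  shows "\<phi> \<otimes>\<^bsub>AutoGroup G\<^esub> \<psi> = compose (carrier G) \<phi> \<psi>"
  using assms by (simp add: AutoGroup_def BijGroup_def auto_def)

lemma one_AutoGroup: "\<one>\<^bsub>AutoGroup G\<^esub> = (\<lambda>x \<in> carrier G. x)"
  by (simp add: AutoGroup_def BijGroup_def)

context group
begin

lemma center_carrier: "x \<in> center G \<Longrightarrow> x \<in> carrier G"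
  by (simp add: center_def)

lemma center_comm: "x \<in> center G \<Longrightarrow> y \<in> carrier G \<Longrightarrow> x \<otimes> y = y \<otimes> x"
  by (simp add: center_def)

lemma center_iff: "x \<in> carrier G \<Longrightarrow> x \<in> center G \<longleftrightarrow> (\<forall>y \<in> carrier G. x \<otimes> y = y \<otimes> x)"
  by (simp add: center_def)

lemma centerI:
  "\<lbrakk>x \<in> carrier G; \<And>y. y \<in> carrier G \<Longrightarrow> x \<otimes> y = y \<otimes> x\<rbrakk> \<Longrightarrow> x \<in> center G"
  by (simp add: center_def)

lemma center_subgroup: "subgroup (center G) G"
proof (rule subgroupI)
  show "center G \<noteq> {}"
    by (auto simp: center_def)
next
  fix x assume x: "x \<in> center G"
  then have "inv x \<otimes> y = y \<otimes> inv x" if "y \<in> carrier G" for y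
    using that int_pow_comm[of x y "- 1" 1] center_comm[OF x that] center_carrier[OF x]
    by (simp add: int_pow_neg)
  then show "inv x \<in> center G"
    using center_carrier[OF x] by (intro centerI) simp_all
next
  fix x y assume xy: "x \<in> center G" "y \<in> center G"
  have "x \<otimes> y \<otimes> w = w \<otimes> (x \<otimes> y)" if "w \<in> carrier G" for w
    using that xy[THEN center_carrier]
    by (simp add: m_assoc center_comm[OF xy(2) that] commute_left[OF center_comm[OF xy(1) that]])
  then show "x \<otimes> y \<in> center G"
    using xy[THEN center_carrier] by (intro centerI) simp_all
qed (auto simp: center_def)

lemma center_normal: "center G \<lhd> G"
  unfolding normal_inv_iff
proof (intro conjI ballI)
  fix x h assume "x \<in> carrier G" "h \<in> center G"
  then show "x \<otimes> h \<otimes> inv x \<in> center G"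
    using center_comm[of h x] center_carrier[of h] by (metis inv_solve_right' m_closed)
qed (rule center_subgroup)

lemma rcoset_in_center_iff:
  assumes "N \<lhd> G" "x \<in> carrier G"
  shows "N #> x \<in> center (G Mod N) \<longleftrightarrow> (\<forall>y \<in> carrier G. x \<otimes> y \<in> N #> (y \<otimes> x))"
proof -
  interpret N: normal N G by fact
  have eq: "N #> u = N #> v \<longleftrightarrow> u \<in> N #> v" if "u \<in> carrier G" "v \<in> carrier G" for u v
    using that repr_independence[OF _ _ N.subgroup_axioms] rcos_self[OF _ N.subgroup_axioms]
    by metis
  show ?thesis
    using assms(2) eq
    by (auto simp: center_def carrier_FactGroup N.rcos_sum)
qed

lemma upper_central_1: "upper_central G 1 = center G"
proof -
  have "{\<one>} #> y = {y}" if "y \<in> carrier G" for y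
    using that by (simp add: r_coset_def)
  then have "{\<one>} #> x \<in> center (G Mod {\<one>}) \<longleftrightarrow> x \<in> center G" if "x \<in> carrier G" for x
    using rcoset_in_center_iff[OF one_is_normal that] that by (auto simp: center_iff)
  then show ?thesis
    by (auto dest: center_carrier)
qed

lemma upper_central_2:
  assumes "x \<in> upper_central G 2"
  shows "x \<in> carrier G" "\<And>y. y \<in> carrier G \<Longrightarrow> \<exists>w \<in> center G. x \<otimes> y = w \<otimes> (y \<otimes> x)"
proof -
  have "x \<in> carrier G \<and> center G #> x \<in> center (G Mod center G)"
    using assms by (simp add: numeral_2_eq_2 upper_central_1[simplified])
  then show "x \<in> carrier G" "\<And>y. y \<in> carrier G \<Longrightarrow> \<exists>w \<in> center G. x \<otimes> y = w \<otimes> (y \<otimes> x)"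
    using rcoset_in_center_iff[OF center_normal] by (auto simp: r_coset_def)
qed

text \<open>An automorphism acts trivially on the quotient by the centre iff it maps each coset onto
itself. Given the elementwise condition, it maps each coset into itself, and onto because it is
surjective and the cosets partition the group.\<close>

lemma Aut_1_eq: "Aut_i 1 G = {\<phi> \<in> auto G. \<forall>x \<in> carrier G. \<exists>w \<in> center G. \<phi> x = w \<otimes> x}"
proof -
  interpret Z: normal "center G" G
    by (rule center_normal)
  have *: "(\<forall>C \<in> carrier (G Mod center G). \<phi> ` C = C) \<longleftrightarrow>
      (\<forall>x \<in> carrier G. \<exists>w \<in> center G. \<phi> x = w \<otimes> x)" if \<phi>: "\<phi> \<in> auto G" for \<phi>
  proof
    assume *: "\<forall>C \<in> carrier (G Mod center G). \<phi> ` C = C"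
    show "\<forall>x \<in> carrier G. \<exists>w \<in> center G. \<phi> x = w \<otimes> x"
    proof
      fix x assume x: "x \<in> carrier G"
      then have "\<phi> ` (center G #> x) = center G #> x"
        using * by (simp add: carrier_FactGroup)
      then have "\<phi> x \<in> center G #> x"
        using rcos_self[OF x center_subgroup] by blast
      then show "\<exists>w \<in> center G. \<phi> x = w \<otimes> x"
        by (auto simp: r_coset_def)
    qed
  next
    assume *: "\<forall>x \<in> carrier G. \<exists>w \<in> center G. \<phi> x = w \<otimes> x"
    have same: "center G #> \<phi> x = center G #> x" if x: "x \<in> carrier G" for x
    proof -
      have "\<phi> x \<in> center G #> x"
        using * x by (auto simp: r_coset_def)
      then show ?thesis
        using repr_independence[OF _ x center_subgroup] by simp
    qed
    have "\<phi> ` C = C" if C: "C \<in> rcosets (center G)" for C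
    proof -
      have mem: "x \<in> C \<longleftrightarrow> x \<in> carrier G \<and> C = center G #> x" for x
        using C rcos_self[OF _ center_subgroup] repr_independence[OF _ _ center_subgroup]
          r_coset_subset_G[OF Z.subset, THEN subsetD]
        by (auto simp: RCOSETS_def)
      have bij: "\<phi> ` carrier G = carrier G"
        using \<phi> by (auto simp: auto_def Bij_def bij_betw_def)
      show ?thesis
      proof (intro equalityI subsetI)
        fix y assume "y \<in> \<phi> ` C"
        then show "y \<in> C"
          using mem same bij by auto
      next
        fix y assume y: "y \<in> C"
        then obtain x where "x \<in> carrier G" "y = \<phi> x"
          using mem bij by (metis imageE)
        then show "y \<in> \<phi> ` C"
          using y mem same by auto
      qed
    qed
    then show "\<forall>C \<in> carrier (G Mod center G). \<phi> ` C = C"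
      by (simp add: FactGroup_def)
  qed
  have "aut_quot G 1 \<phi> = \<one>\<^bsub>AutoGroup (G Mod center G)\<^esub> \<longleftrightarrow>
      (\<forall>C \<in> carrier (G Mod center G). \<phi> ` C = C)" for \<phi>
    unfolding aut_quot_def one_AutoGroup upper_central_1
    by (metis (no_types, lifting) restrict_apply' restrict_ext)
  then show ?thesis
    unfolding Aut_i_def kernel_def carrier_AutoGroup upper_central_1
    by (intro Collect_cong conj_cong) (simp_all only: *)
qed

end

section \<open>Multiplying the generators by central elements\<close>

text \<open>The universal property of the presentation, restricted to endomorphisms.\<close>

locale macdonald_aut = macdonald_group +
  assumes extend: "\<lbrakk>a' \<in> carrier G; b' \<in> carrier G; macdonald_rels G a' b' Q r\<rbrakk>
    \<Longrightarrow> \<exists>\<phi> \<in> hom G G. \<phi> a = a' \<and> \<phi> b = b'"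
begin

lemma hom_eqI:
  assumes "\<phi> \<in> hom G G" "\<psi> \<in> hom G G" "\<phi> a = \<psi> a" "\<phi> b = \<psi> b" "x \<in> carrier G"
  shows "\<phi> x = \<psi> x"
proof -
  obtain w where x: "x = weval G (case_gen a b) w"
    using generated assms(5) by blast
  have eq: "\<phi> \<circ> case_gen a b = \<psi> \<circ> case_gen a b"
    using assms(3,4) by (auto split: gen.split)
  have range: "range (case_gen a b) \<subseteq> carrier G"
    by (auto split: gen.split)
  show ?thesis
    unfolding x by (simp only: weval_hom[OF is_group is_group _ range] assms(1,2) eq)
qed

lemma center_pow_mult_Q:
  assumes "x \<in> center G"
  shows "x [^] (Q * n) = \<one>"
  using int_pow_pow[of x Q n] center_pow_Q[OF assms] center_carrier[OF assms] by simp

text \<open>Central factors cancel from the commutator. In the other relations they occur to powers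
that differ by a multiple of \<open>Q\<close> on the two sides, and their \<open>Q\<close>th powers are trivial.\<close>

lemma rels_twist:
  assumes x: "x \<in> center G" and y: "y \<in> center G"
  shows "inv (a \<otimes> x) \<otimes> inv (b \<otimes> y) \<otimes> (a \<otimes> x) \<otimes> (b \<otimes> y) = c"
    and "macdonald_rels G (a \<otimes> x) (b \<otimes> y) Q r"
proof -
  note [simp] = center_carrier[OF x] center_carrier[OF y]
  have xs: "x \<otimes> a = a \<otimes> x" "x \<otimes> b = b \<otimes> x" "x \<otimes> c = c \<otimes> x"
    "y \<otimes> a = a \<otimes> y" "y \<otimes> b = b \<otimes> y" "y \<otimes> c = c \<otimes> y" "y \<otimes> x = x \<otimes> y"
    using x y by (blast intro: center_comm center_carrier a_carr b_carr c_carr)+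
  have "(a \<otimes> x) \<otimes> (b \<otimes> y) = (b \<otimes> y) \<otimes> ((a \<otimes> x) \<otimes> c)"
    by (simp add: m_assoc xs commute_left[OF xs(2)] commute_left[OF xs(4)]
        commute_left[OF xs(6)] commute_left[OF xs(7)])
      (simp add: m_assoc[symmetric] ab commute_left)
  then show c': "inv (a \<otimes> x) \<otimes> inv (b \<otimes> y) \<otimes> (a \<otimes> x) \<otimes> (b \<otimes> y) = c"
    by (simp add: m_assoc inv_solve_left')
  have xc: "inv c \<otimes> (a \<otimes> x) \<otimes> c = inv c \<otimes> a \<otimes> c \<otimes> x"
    by (simp add: m_assoc xs)
  have yc: "c \<otimes> (b \<otimes> y) \<otimes> inv c = c \<otimes> b \<otimes> inv c \<otimes> y"
    using center_comm[OF y, of "inv c"] by (simp add: m_assoc)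
  have xp: "(a \<otimes> x) [^] n = a [^] n \<otimes> x [^] n" and yp: "(b \<otimes> y) [^] n = b [^] n \<otimes> y [^] n"
    for n :: int
    by (simp_all add: int_pow_mult_distrib xs)
  have "w [^] (1 + 2 * Q * r) = w" "w [^] (2 * Q * Q) = \<one>" if "w \<in> center G" for w
    using center_pow_mult_Q[OF that, of "2 * r"] center_pow_mult_Q[OF that, of "2 * Q"]
      int_pow_mult[of w 1 "2 * Q * r"] center_carrier[OF that]
    by (simp_all add: mult_ac)
  then show "macdonald_rels G (a \<otimes> x) (b \<otimes> y) Q r"
    using x y unfolding macdonald_rels_def Let_def c' xc yc a_conj_c b_conj_c
    by (simp add: xp yp a_order b_order c_order)
qed

lemma twist_nf:
  assumes x: "x \<in> center G" and y: "y \<in> center G"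
    and \<phi>: "\<phi> \<in> hom G G" "\<phi> a = a \<otimes> x" "\<phi> b = b \<otimes> y"
  shows "\<phi> (nf i j k) = x [^] i \<otimes> y [^] j \<otimes> nf i j k"
proof -
  interpret \<phi>: group_hom G G \<phi>
    using \<phi>(1) by unfold_locales
  note [simp] = center_carrier[OF x] center_carrier[OF y]
  have "\<phi> c = c"
    using rels_twist(1)[OF x y] by (simp add: c_def \<phi>(2,3))
  then have "\<phi> (nf i j k) = (a \<otimes> x) [^] i \<otimes> ((b \<otimes> y) [^] j \<otimes> c [^] k)"
    by (simp add: nf_def \<phi>.hom_int_pow \<phi>(2,3))
  also have "\<dots> = a [^] i \<otimes> x [^] i \<otimes> (b [^] j \<otimes> y [^] j \<otimes> c [^] k)"
    using center_comm[OF x a_carr] center_comm[OF y b_carr]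
    by (simp add: int_pow_mult_distrib)
  also have "a [^] i \<otimes> x [^] i = x [^] i \<otimes> a [^] i"
    using center_comm[OF x a_carr] by (simp add: int_pow_comm)
  also have "b [^] j \<otimes> y [^] j = y [^] j \<otimes> b [^] j"
    using center_comm[OF y b_carr] by (simp add: int_pow_comm)
  also have "x [^] i \<otimes> a [^] i \<otimes> (y [^] j \<otimes> b [^] j \<otimes> c [^] k) =
      x [^] i \<otimes> (a [^] i \<otimes> y [^] j) \<otimes> (b [^] j \<otimes> c [^] k)"
    by (simp add: m_assoc)
  also have "a [^] i \<otimes> y [^] j = y [^] j \<otimes> a [^] i"
    using center_comm[OF y a_carr] by (simp add: int_pow_comm)
  also have "x [^] i \<otimes> (y [^] j \<otimes> a [^] i) \<otimes> (b [^] j \<otimes> c [^] k) = x [^] i \<otimes> y [^] j \<otimes> nf i j k"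
    by (simp add: nf_def m_assoc)
  finally show ?thesis .
qed

text \<open>On these elements the exponents of \<open>a\<close> and \<open>b\<close> in the normal form are multiples of \<open>Q\<close>, so
that the factor \<open>x\<^sup>i y\<^sup>j\<close> is trivial.\<close>

lemma twist_fixes:
  assumes "x \<in> center G" "y \<in> center G"
    and "\<phi> \<in> hom G G" "\<phi> a = a \<otimes> x" "\<phi> b = b \<otimes> y"
  shows "w \<in> upper_central G 2 \<Longrightarrow> \<phi> w = w" and "w \<in> center G \<Longrightarrow> \<phi> w = w"
proof -
  have *: "\<phi> (nf (Q * i) (Q * j) k) = nf (Q * i) (Q * j) k" for i j k
    using assms by (simp add: twist_nf center_pow_mult_Q)
  then show "\<phi> w = w" if "w \<in> upper_central G 2"
    using second_centerE[OF upper_central_2[OF that]] by metis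
  show "\<phi> w = w" if "w \<in> center G"
    using that *[of "2 * _" "2 * _" 0] by (auto simp: center_eq central_elt_def mult_ac)
qed

text \<open>The inverse of the endomorphism with parameters \<open>x\<close>, \<open>y\<close> is the one with parameters \<open>x\<inverse>\<close>,
\<open>y\<inverse>\<close>: since each of them fixes the centre, both composites fix \<open>a\<close> and \<open>b\<close>.\<close>

lemma ex1_twist:
  assumes x: "x \<in> center G" and y: "y \<in> center G"
  shows "\<exists>!\<phi>. \<phi> \<in> auto G \<and> \<phi> a = a \<otimes> x \<and> \<phi> b = b \<otimes> y"
proof (rule ex_ex1I)
  interpret Z: subgroup "center G" G
    by (rule center_subgroup)
  have ex: "\<exists>\<phi> \<in> hom G G. \<phi> a = a \<otimes> x \<and> \<phi> b = b \<otimes> y" if "x \<in> center G" "y \<in> center G" for x y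
    using that by (intro extend) (simp_all add: rels_twist center_carrier)
  obtain \<phi> where \<phi>: "\<phi> \<in> hom G G" "\<phi> a = a \<otimes> x" "\<phi> b = b \<otimes> y"
    using ex[OF x y] by blast
  obtain \<psi> where \<psi>: "\<psi> \<in> hom G G" "\<psi> a = a \<otimes> inv x" "\<psi> b = b \<otimes> inv y"
    using ex[of "inv x" "inv y"] x y by blast
  interpret \<phi>: group_hom G G \<phi>
    using \<phi>(1) by unfold_locales
  interpret \<psi>: group_hom G G \<psi>
    using \<psi>(1) by unfold_locales
  have id: "(\<lambda>w. w) \<in> hom G G"
    by (simp add: hom_def)
  note [simp] = center_carrier[OF x] center_carrier[OF y]
  have fixed: "\<phi> (inv x) = inv x" "\<phi> (inv y) = inv y" "\<psi> x = x" "\<psi> y = y"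
    using twist_fixes(2)[OF x y \<phi>] twist_fixes(2)[OF _ _ \<psi>] x y by auto
  have inverse: "\<phi> (\<psi> w) = w" "\<psi> (\<phi> w) = w" if "w \<in> carrier G" for w
    using hom_eqI[OF Group.hom_compose[OF \<psi>(1) \<phi>(1)] id _ _ that]
      hom_eqI[OF Group.hom_compose[OF \<phi>(1) \<psi>(1)] id _ _ that]
    by (simp_all add: \<phi>(2,3) \<psi>(2,3) fixed m_assoc del: \<phi>.hom_inv \<psi>.hom_inv)
  have "bij_betw \<phi> (carrier G) (carrier G)"
    by (rule bij_betw_byWitness[of _ \<psi>]) (auto simp: inverse)
  then have "restrict \<phi> (carrier G) \<in> auto G"
    using \<phi>(1) by (auto simp: auto_def Bij_def hom_def bij_betw_restrict_eq)
  then show "\<exists>\<phi>. \<phi> \<in> auto G \<and> \<phi> a = a \<otimes> x \<and> \<phi> b = b \<otimes> y"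
    using \<phi>(2,3) by (intro exI[of _ "restrict \<phi> (carrier G)"]) simp
next
  fix \<phi> \<psi>
  assume *: "\<phi> \<in> auto G \<and> \<phi> a = a \<otimes> x \<and> \<phi> b = b \<otimes> y"
    "\<psi> \<in> auto G \<and> \<psi> a = a \<otimes> x \<and> \<psi> b = b \<otimes> y"
  show "\<phi> = \<psi>"
  proof (rule extensionalityI)
    show "\<phi> \<in> extensional (carrier G)" "\<psi> \<in> extensional (carrier G)"
      using * by (simp_all add: auto_def Bij_def)
    show "\<phi> w = \<psi> w" if "w \<in> carrier G" for w
      using * that by (rule_tac hom_eqI) (simp_all add: auto_def)
  qed
qed

lemma Omega_spec:
  assumes "x \<in> center G" "y \<in> center G"
  shows "Omega G a b (x, y) \<in> auto G" "Omega G a b (x, y) \<in> hom G G"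
    "Omega G a b (x, y) a = a \<otimes> x" "Omega G a b (x, y) b = b \<otimes> y"
  using theI'[OF ex1_twist[OF assms]] by (auto simp: Omega_def carrier_AutoGroup auto_def)

lemma Omega_central:
  assumes "x \<in> center G" "y \<in> center G"
  shows "Omega G a b (x, y) \<in> Aut_i 1 G"
  unfolding Aut_1_eq
proof (intro CollectI conjI ballI)
  interpret Z: subgroup "center G" G
    by (rule center_subgroup)
  fix w assume "w \<in> carrier G"
  then obtain i j k where w: "w = nf i j k"
    by (rule nf_exhaust)
  have "x [^] i \<in> center G" if "x \<in> center G" for x and i :: int
    using int_pow_comm[of x _ i 1] center_comm[OF that] center_carrier[OF that]
    by (intro centerI) simp_all
  then have "x [^] i \<otimes> y [^] j \<in> center G"
    using assms by simp
  then show "\<exists>v \<in> center G. Omega G a b (x, y) w = v \<otimes> w"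
    using twist_nf[OF assms Omega_spec(2-4)[OF assms]] w by auto
qed (rule Omega_spec[OF assms])

lemma Omega_hom:
  "Omega G a b \<in> hom (G\<lparr>carrier := center G\<rparr> \<times>\<times> G\<lparr>carrier := center G\<rparr>) (AutoGroup G)"
proof (rule homI)
  interpret Z: subgroup "center G" G
    by (rule center_subgroup)
  fix p q
  assume "p \<in> carrier (G\<lparr>carrier := center G\<rparr> \<times>\<times> G\<lparr>carrier := center G\<rparr>)"
  then obtain x y where p: "p = (x, y)" and xy: "x \<in> center G" "y \<in> center G"
    by auto
  then show "Omega G a b p \<in> carrier (AutoGroup G)"
    by (simp add: carrier_AutoGroup Omega_spec)
  assume "q \<in> carrier (G\<lparr>carrier := center G\<rparr> \<times>\<times> G\<lparr>carrier := center G\<rparr>)"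
  then obtain u v where q: "q = (u, v)" and uv: "u \<in> center G" "v \<in> center G"
    by auto
  have *: "x \<otimes> u \<in> center G" "y \<otimes> v \<in> center G"
    using xy uv by auto
  note carrs [simp] = xy[THEN center_carrier] uv[THEN center_carrier]
  let ?\<omega> = "compose (carrier G) (Omega G a b (x, y)) (Omega G a b (u, v))"
  have mult: "Omega G a b p \<otimes>\<^bsub>AutoGroup G\<^esub> Omega G a b q = ?\<omega>"
    using xy uv by (simp add: p q mult_AutoGroup Omega_spec)
  have "?\<omega> \<in> auto G"
    using xy uv monoid.m_closed[OF group.is_monoid[OF AutoGroup]] mult
    by (metis carrier_AutoGroup Omega_spec(1) p q)
  moreover have "?\<omega> a = a \<otimes> (x \<otimes> u)"
    using Omega_spec[OF xy] Omega_spec[OF uv] uv twist_fixes(2)[OF xy Omega_spec(2-4)[OF xy]]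
    by (simp add: compose_def hom_mult m_assoc)
  moreover have "?\<omega> b = b \<otimes> (y \<otimes> v)"
    using Omega_spec[OF xy] Omega_spec[OF uv] uv twist_fixes(2)[OF xy Omega_spec(2-4)[OF xy]]
    by (simp add: compose_def hom_mult m_assoc)
  ultimately have "?\<omega> = Omega G a b (x \<otimes> u, y \<otimes> v)"
    using ex1_twist[OF *] Omega_spec[OF *] by blast
  then show "Omega G a b (p \<otimes>\<^bsub>G\<lparr>carrier := center G\<rparr> \<times>\<times> G\<lparr>carrier := center G\<rparr>\<^esub> q) =
      Omega G a b p \<otimes>\<^bsub>AutoGroup G\<^esub> Omega G a b q"
    by (simp add: mult) (simp add: p q)
qed

lemma Omega_inj: "inj_on (Omega G a b) (center G \<times> center G)"
proof (rule inj_onI, clarify)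
  fix x y u v
  assume *: "x \<in> center G" "y \<in> center G" "u \<in> center G" "v \<in> center G"
    "Omega G a b (x, y) = Omega G a b (u, v)"
  then have "a \<otimes> x = a \<otimes> u" "b \<otimes> y = b \<otimes> v"
    using Omega_spec(3,4)[of x y] Omega_spec(3,4)[of u v] by simp_all
  then show "x = u \<and> y = v"
    using *(1-4)[THEN center_carrier] by simp
qed

lemma Omega_image: "Omega G a b ` (center G \<times> center G) = Aut_i 1 G"
proof (intro equalityI subsetI)
  fix \<phi> assume \<phi>: "\<phi> \<in> Aut_i 1 G"
  then obtain x y where xy: "x \<in> center G" "y \<in> center G" "\<phi> a = x \<otimes> a" "\<phi> b = y \<otimes> b"
    unfolding Aut_1_eq using a_carr b_carr by blast
  then have "\<phi> a = a \<otimes> x" "\<phi> b = b \<otimes> y"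
    using center_comm[OF xy(1) a_carr] center_comm[OF xy(2) b_carr] by simp_all
  moreover have "\<phi> \<in> auto G"
    using \<phi> unfolding Aut_1_eq by simp
  ultimately have "\<phi> = Omega G a b (x, y)"
    using ex1_twist[OF xy(1,2)] Omega_spec[OF xy(1,2)] by blast
  then show "\<phi> \<in> Omega G a b ` (center G \<times> center G)"
    using xy by blast
qed (use Omega_central in auto)

lemma card_Aut_1: "card (Aut_i 1 G) = nat Q ^ 4"
  using card_image[OF Omega_inj]
  by (simp add: Omega_image card_cartesian_product card_center power_mult_distrib flip: power_add)

end

section \<open>The presented group\<close>

text \<open>The universal property is used twice: with target \<open>K\<close> for the endomorphisms, and with
target the quotient of \<open>nil3\<close> for the uniqueness of the normal form.\<close>

lemma macdonald_aut_of_K_presentation: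
  assumes "m > 1" "odd l" "K_presentation K a b m l"
  shows "macdonald_aut K a b (2 ^ (m - 1)) l"
proof -
  let ?Q = "2 ^ (m - 1) :: int"
  have pres: "has_presentation K (case_gen a b) (K_rels m l)"
    using assms(3) by (simp add: K_presentation_def)
  interpret K: group K
    using pres by (simp add: has_presentation_def)
  have ab: "a \<in> carrier K" "b \<in> carrier K"
    using has_presentation_range[OF pres] by (force split: gen.split)+
  have rels: "macdonald_rels K a b ?Q l"
    using K.K_rels_iff[OF ab, of m l] has_presentation_rel[OF pres] assms(1) by auto
  interpret K: macdonald_pair K a b ?Q l
    by unfold_locales (use ab rels in auto)
  have ext: "\<exists>\<phi> \<in> hom K H. \<phi> a = a' \<and> \<phi> b = b'"
    if H: "group H" and a'b': "a' \<in> carrier H" "b' \<in> carrier H" and rels': "macdonald_rels H a' b' ?Q l"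
    for H :: "('c, 'd) monoid_scheme" and a' b'
  proof -
    have "\<exists>\<phi> \<in> hom K H. \<forall>x. \<phi> (case_gen a b x) = case_gen a' b' x"
    proof (rule has_presentation_extend[OF pres H])
      show "range (case_gen a' b') \<subseteq> carrier H"
        using a'b' by (auto split: gen.split)
      show "weval H (case_gen a' b') u = weval H (case_gen a' b') v" if "(u, v) \<in> K_rels m l" for u v
        using group.K_rels_iff[OF H a'b', of m l] rels' assms(1) that by auto
    qed
    then show ?thesis
      by (metis gen.case)
  qed
  show ?thesis
  proof unfold_locales
    fix i j k assume nf: "K.nf i j k = \<one>\<^bsub>K\<^esub>"
    let ?H = "nil3 Mod nil3_lattice ?Q l"
    interpret \<pi>: group_hom nil3 ?H "nil3_coset ?Q l"
      by (rule nil3_coset_hom)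
    obtain \<phi> where \<phi>: "\<phi> \<in> hom K ?H" "\<phi> a = nil3_coset ?Q l (1, 0, 0, 0, 0)"
        "\<phi> b = nil3_coset ?Q l (0, 1, 0, 0, 0)"
      using ext[OF \<pi>.H.is_group \<pi>.hom_closed \<pi>.hom_closed macdonald_rels_nil3_coset] by auto
    interpret \<phi>: group_hom K ?H \<phi>
      using \<phi>(1) by unfold_locales
    have "\<phi> K.c = nil3_coset ?Q l (0, 0, 1, 0, 0)"
      using ab by (simp add: K.c_def \<phi>(2,3) nil3_coset_commutator del: mult_FactGroup)
    then have "\<phi> (K.nf i j k) = nil3_coset ?Q l (i, j, k, 0, 0)"
      using ab by (simp add: K.nf_def \<phi>.hom_int_pow \<phi>(2,3) nil3_coset_simps nil3_pow mult_nil3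
          del: mult_FactGroup)
    then have "(i, j, k, 0, 0) \<in> nil3_lattice ?Q l"
      unfolding nf using nil3_coset_eq_one by (metis \<phi>.hom_one)
    then show "2 * ?Q * ?Q dvd i \<and> 2 * ?Q * ?Q dvd j \<and> ?Q dvd k"
      by (simp add: mem_nil3_lattice)
  qed (use assms(1,2) ext[OF K.is_group] has_presentation_generated[OF pres] in auto)
qed

theorem proposition5p1:
  fixes K :: "('g, 'h) monoid_scheme" and a b :: 'g and m :: nat and l :: int
  assumes "m > 1" and "odd l" and "K_presentation K a b m l"
  shows
    "(\<forall>x \<in> upper_central K 1. \<forall>y \<in> upper_central K 1.
        (\<exists>!\<phi>. \<phi> \<in> carrier (AutoGroup K) \<and> \<phi> a = a \<otimes>\<^bsub>K\<^esub> x \<and> \<phi> b = b \<otimes>\<^bsub>K\<^esub> y) \<and>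
        Omega K a b (x, y) \<in> Aut_i 1 K \<and>
        (\<forall>z \<in> upper_central K 2. Omega K a b (x, y) z = z)) \<and>
     Omega K a b \<in> mon (K\<lparr>carrier := upper_central K 1\<rparr> \<times>\<times> K\<lparr>carrier := upper_central K 1\<rparr>) (AutoGroup K) \<and>
     Omega K a b ` (upper_central K 1 \<times> upper_central K 1) = Aut_i 1 K \<and>
     card (Aut_i 1 K) = 2 ^ (4 * (m - 1))"
proof -
  interpret macdonald_aut K a b "2 ^ (m - 1)" l
    using assms by (rule macdonald_aut_of_K_presentation)
  have "card (Aut_i 1 K) = 2 ^ (4 * (m - 1))"
    unfolding card_Aut_1 by (simp add: nat_power_eq power_mult mult.commute[of 4])
  moreover have "Omega K a b (x, y) z = z"
    if "x \<in> center K" "y \<in> center K" "z \<in> upper_central K 2" for x y z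
    using twist_fixes(1)[OF that(1,2) Omega_spec(2-4)[OF that(1,2)] that(3)] .
  ultimately show ?thesis
    using ex1_twist Omega_central Omega_hom Omega_inj Omega_image
    unfolding upper_central_1 carrier_AutoGroup mon_def by simp
qed

end
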